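(* Let $H$ be an arbitrary Hopf algebra over a field of characteristic $0$ and let $B$ be a finite dimensional semisimple Lie algebra over this field that is an $H$-module Lie algebra. Then $B=B_1\oplus B_2\oplus\dots\oplus B_s$ (direct sum of ideals of $B$ that are $H$-submodules) for some $H$-simple subalgebras $B_i$.
   Context: Sweedler notation: $\Delta(h)=h_{(1)}\otimes h_{(2)}$ for the comultiplication of $H$. A Lie algebra $L$ that is a left $H$-module is an $H$-module Lie algebra if $h[a,b]=[h_{(1)}a,h_{(2)}b]$ for all $h\in H$, $a,b\in L$. An $H$-module Lie algebra $B$ is $H$-simple if for every ideal $I$ of $B$ that is an $H$-submodule, either $I=0$ or $I=B$. *)

theory Defs
  imports HOL.Vector_Spaces "HOL-Library.Poly_Mapping" "HOL-Library.FuncSet"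
begin

section \<open>Tensor powers of a vector space\<close>

text \<open>
  The type \<^typ>\<open>'x \<Rightarrow>\<^sub>0 'k\<close> is the free vector space on \<^typ>\<open>'x\<close>. The tensor products
  \<open>V \<otimes> V\<close> and \<open>V \<otimes> V \<otimes> V\<close> are its quotients, for \<open>'x = V \<times> V\<close> and
  \<open>'x = V \<times> V \<times> V\<close>, by the subspace of multilinearity relations. Tensors are represented by
  cosets; the basis vector \<open>gen (x, y)\<close> represents \<open>x \<otimes> y\<close>.
\<close>

definition free_scale :: "'k::field \<Rightarrow> ('x \<Rightarrow>\<^sub>0 'k) \<Rightarrow> ('x \<Rightarrow>\<^sub>0 'k)" where
  "free_scale c t = Poly_Mapping.map ((*) c) t"

lemma lookup_free_scale [simp]:
  "Poly_Mapping.lookup (free_scale c t) x = c * Poly_Mapping.lookup t x"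
  by (simp add: free_scale_def Poly_Mapping.map.rep_eq when_def)

global_interpretation free: vector_space "free_scale :: 'k::field \<Rightarrow> ('x \<Rightarrow>\<^sub>0 'k) \<Rightarrow> ('x \<Rightarrow>\<^sub>0 'k)"
  by unfold_locales (auto intro!: poly_mapping_eqI simp: lookup_add algebra_simps)

abbreviation gen :: "'x \<Rightarrow> ('x \<Rightarrow>\<^sub>0 'k::field)" where
  "gen x \<equiv> Poly_Mapping.single x 1"

text \<open>The linear extension to the free vector space of a map \<open>f\<close> given on its basis.\<close>

definition lin_ext ::
  "('k::field \<Rightarrow> 'v::ab_group_add \<Rightarrow> 'v) \<Rightarrow> ('x \<Rightarrow> 'v) \<Rightarrow> ('x \<Rightarrow>\<^sub>0 'k) \<Rightarrow> 'v" where
  "lin_ext scale f t = (\<Sum>x\<in>Poly_Mapping.keys t. scale (Poly_Mapping.lookup t x) (f x))"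

definition relations2 ::
  "('k::field \<Rightarrow> 'v::ab_group_add \<Rightarrow> 'v) \<Rightarrow> ('v \<times> 'v \<Rightarrow>\<^sub>0 'k) set" where
  "relations2 scale = free.span
     ({gen (x + x', y) - gen (x, y) - gen (x', y) | x x' y. True} \<union>
      {gen (x, y + y') - gen (x, y) - gen (x, y') | x y y'. True} \<union>
      {gen (scale c x, y) - free_scale c (gen (x, y)) | c x y. True} \<union>
      {gen (x, scale c y) - free_scale c (gen (x, y)) | c x y. True})"

definition relations3 ::
  "('k::field \<Rightarrow> 'v::ab_group_add \<Rightarrow> 'v) \<Rightarrow> ('v \<times> 'v \<times> 'v \<Rightarrow>\<^sub>0 'k) set" where
  "relations3 scale = free.span
     ({gen (x + x', y, z) - gen (x, y, z) - gen (x', y, z) | x x' y z. True} \<union>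
      {gen (x, y + y', z) - gen (x, y, z) - gen (x, y', z) | x y y' z. True} \<union>
      {gen (x, y, z + z') - gen (x, y, z) - gen (x, y, z') | x y z z'. True} \<union>
      {gen (scale c x, y, z) - free_scale c (gen (x, y, z)) | c x y z. True} \<union>
      {gen (x, scale c y, z) - free_scale c (gen (x, y, z)) | c x y z. True} \<union>
      {gen (x, y, scale c z) - free_scale c (gen (x, y, z)) | c x y z. True})"

definition tensor_class2 ::
  "('k::field \<Rightarrow> 'v::ab_group_add \<Rightarrow> 'v) \<Rightarrow> ('v \<times> 'v \<Rightarrow>\<^sub>0 'k) \<Rightarrow> ('v \<times> 'v \<Rightarrow>\<^sub>0 'k) set" where
  "tensor_class2 scale t = {u. u - t \<in> relations2 scale}"

definition tensor_class3 ::
  "('k::field \<Rightarrow> 'v::ab_group_add \<Rightarrow> 'v) \<Rightarrow> ('v \<times> 'v \<times> 'v \<Rightarrow>\<^sub>0 'k) \<Rightarrow> ('v \<times> 'v \<times> 'v \<Rightarrow>\<^sub>0 'k) set" where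
  "tensor_class3 scale t = {u. u - t \<in> relations3 scale}"

definition tensor_square ::
  "('k::field \<Rightarrow> 'v::ab_group_add \<Rightarrow> 'v) \<Rightarrow> ('v \<times> 'v \<Rightarrow>\<^sub>0 'k) set set" where
  "tensor_square scale = range (tensor_class2 scale)"

section \<open>Hopf algebras\<close>

locale k_algebra = vector_space scale
  for scale :: "'k::field \<Rightarrow> 'h::ring_1 \<Rightarrow> 'h" +
  assumes scale_mult_left: "scale c x * y = scale c (x * y)"
    and scale_mult_right: "x * scale c y = scale c (x * y)"

text \<open>
  The class \<^class>\<open>ring_1\<close> includes \<open>0 \<noteq> 1\<close>, which is no restriction, as a counit sends
  the unit to \<open>1 \<noteq> 0\<close>. The antipode is not required to be bijective.

  Identities between maps induced on tensor products are stated for arbitrary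
  representatives of the cosets. In \<open>coassoc\<close>, \<open>d\<close> chooses a representative
  of every \<open>\<Delta> x\<close>, and the two sides represent \<open>(\<Delta> \<otimes> id) (\<Delta> h)\<close> and
  \<open>(id \<otimes> \<Delta>) (\<Delta> h)\<close>.
\<close>

locale hopf_algebra = k_algebra scale
  for scale :: "'k::field \<Rightarrow> 'h::ring_1 \<Rightarrow> 'h" +
  fixes \<Delta> :: "'h \<Rightarrow> ('h \<times> 'h \<Rightarrow>\<^sub>0 'k) set"
    and \<epsilon> :: "'h \<Rightarrow> 'k"
    and S :: "'h \<Rightarrow> 'h"
  assumes comult_tensor: "\<Delta> h \<in> tensor_square scale"
    and comult_add: "t \<in> \<Delta> g \<Longrightarrow> u \<in> \<Delta> h \<Longrightarrow> t + u \<in> \<Delta> (g + h)"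
    and comult_scale: "t \<in> \<Delta> h \<Longrightarrow> free_scale c t \<in> \<Delta> (scale c h)"
    and counit_linear: "Vector_Spaces.linear scale (*) \<epsilon>"
    and coassoc: "(\<And>x. d x \<in> \<Delta> x) \<Longrightarrow>
      tensor_class3 scale (lin_ext free_scale
        (\<lambda>(x, y). lin_ext free_scale (\<lambda>(x1, x2). gen (x1, x2, y)) (d x)) (d h)) =
      tensor_class3 scale (lin_ext free_scale
        (\<lambda>(x, y). lin_ext free_scale (\<lambda>(y1, y2). gen (x, y1, y2)) (d y)) (d h))"
    and counit_left: "t \<in> \<Delta> h \<Longrightarrow> lin_ext scale (\<lambda>(x, y). scale (\<epsilon> x) y) t = h"
    and counit_right: "t \<in> \<Delta> h \<Longrightarrow> lin_ext scale (\<lambda>(x, y). scale (\<epsilon> y) x) t = h"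
    and comult_one: "gen (1, 1) \<in> \<Delta> 1"
    and comult_mult: "t \<in> \<Delta> g \<Longrightarrow> u \<in> \<Delta> h \<Longrightarrow>
      lin_ext free_scale
        (\<lambda>(x, y). lin_ext free_scale (\<lambda>(x', y'). gen (x * x', y * y')) u) t \<in> \<Delta> (g * h)"
    and counit_one: "\<epsilon> 1 = 1"
    and counit_mult: "\<epsilon> (g * h) = \<epsilon> g * \<epsilon> h"
    and antipode_linear: "Vector_Spaces.linear scale scale S"
    and antipode_left: "t \<in> \<Delta> h \<Longrightarrow> lin_ext scale (\<lambda>(x, y). S x * y) t = scale (\<epsilon> h) 1"
    and antipode_right: "t \<in> \<Delta> h \<Longrightarrow> lin_ext scale (\<lambda>(x, y). x * S y) t = scale (\<epsilon> h) 1"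

section \<open>Lie algebras\<close>

locale lie_algebra = vector_space scale
  for scale :: "'k::field \<Rightarrow> 'b::ab_group_add \<Rightarrow> 'b" +
  fixes bracket :: "'b \<Rightarrow> 'b \<Rightarrow> 'b"
  assumes bracket_linear_left: "Vector_Spaces.linear scale scale (\<lambda>x. bracket x y)"
    and bracket_linear_right: "Vector_Spaces.linear scale scale (\<lambda>y. bracket x y)"
    and bracket_self: "bracket x x = 0"
    and jacobi: "bracket x (bracket y z) + bracket y (bracket z x) + bracket z (bracket x y) = 0"
begin

definition lie_subalgebra :: "'b set \<Rightarrow> bool" where
  "lie_subalgebra L \<longleftrightarrow> subspace L \<and> (\<forall>x\<in>L. \<forall>y\<in>L. bracket x y \<in> L)"

definition lie_ideal :: "'b set \<Rightarrow> 'b set \<Rightarrow> bool" where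
  "lie_ideal I L \<longleftrightarrow> subspace I \<and> I \<subseteq> L \<and> (\<forall>x\<in>L. \<forall>y\<in>I. bracket x y \<in> I)"

definition bracket_space :: "'b set \<Rightarrow> 'b set \<Rightarrow> 'b set" where
  "bracket_space L M = span {bracket x y | x y. x \<in> L \<and> y \<in> M}"

primrec derived_series :: "'b set \<Rightarrow> nat \<Rightarrow> 'b set" where
  "derived_series L 0 = L"
| "derived_series L (Suc n) = bracket_space (derived_series L n) (derived_series L n)"

definition solvable :: "'b set \<Rightarrow> bool" where
  "solvable L \<longleftrightarrow> (\<exists>n. derived_series L n = {0})"

text \<open>In finite dimension this says that the solvable radical is zero.\<close>

definition semisimple :: bool where
  "semisimple \<longleftrightarrow> (\<forall>I. lie_ideal I UNIV \<and> solvable I \<longrightarrow> I = {0})"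

text \<open>The whole space is the internal direct sum of \<open>B 1, \<dots>, B s\<close>.\<close>

definition direct_sum :: "nat \<Rightarrow> (nat \<Rightarrow> 'b set) \<Rightarrow> bool" where
  "direct_sum s B \<longleftrightarrow> (\<forall>i\<in>{1..s}. subspace (B i)) \<and>
     (\<forall>x. \<exists>!f. f \<in> (\<Pi>\<^sub>E i\<in>{1..s}. B i) \<and> x = (\<Sum>i\<in>{1..s}. f i))"

end

section \<open>\<open>H\<close>-module Lie algebras\<close>

locale H_module_lie_algebra =
  H: hopf_algebra scaleH \<Delta> \<epsilon> S + lie_algebra scaleB bracket
  for scaleH :: "'k::field \<Rightarrow> 'h::ring_1 \<Rightarrow> 'h"
    and \<Delta> :: "'h \<Rightarrow> ('h \<times> 'h \<Rightarrow>\<^sub>0 'k) set"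
    and \<epsilon> :: "'h \<Rightarrow> 'k"
    and S :: "'h \<Rightarrow> 'h"
    and scaleB :: "'k \<Rightarrow> 'b::ab_group_add \<Rightarrow> 'b"
    and bracket :: "'b \<Rightarrow> 'b \<Rightarrow> 'b" +
  fixes act :: "'h \<Rightarrow> 'b \<Rightarrow> 'b"
  assumes act_linear_left: "Vector_Spaces.linear scaleH scaleB (\<lambda>h. act h b)"
    and act_linear_right: "Vector_Spaces.linear scaleB scaleB (\<lambda>b. act h b)"
    and act_one: "act 1 b = b"
    and act_mult: "act (g * h) b = act g (act h b)"
    and act_bracket: "t \<in> \<Delta> h \<Longrightarrow>
      act h (bracket a b) = lin_ext scaleB (\<lambda>(x, y). bracket (act x a) (act y b)) t"
begin

definition H_submodule :: "'b set \<Rightarrow> bool" where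
  "H_submodule M \<longleftrightarrow> subspace M \<and> (\<forall>h. \<forall>x\<in>M. act h x \<in> M)"

definition H_simple :: "'b set \<Rightarrow> bool" where
  "H_simple L \<longleftrightarrow> lie_subalgebra L \<and> H_submodule L \<and>
     (\<forall>I. lie_ideal I L \<and> H_submodule I \<longrightarrow> I = {0} \<or> I = L)"

end

end

theory Submission
  imports Defs "Jordan_Normal_Form.Char_Poly" "HOL-Algebra.Algebraic_Closure_Type"
begin

text \<open>
  Every \<open>H\<close>-stable ideal \<open>I\<close> of \<open>B\<close> has the \<open>H\<close>-stable complementary ideal \<open>C(I)\<close>, the centralizer
  of \<open>I\<close>. Given this, a minimal nonzero \<open>H\<close>-stable ideal \<open>I\<close> is \<open>H\<close>-simple: since \<open>C(I)\<close> acts on \<open>I\<close>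
  as zero, ideals of \<open>I\<close> are ideals of \<open>B = I + C(I)\<close>. Splitting off minimal \<open>H\<close>-stable ideals one
  after the other, by induction on the dimension, gives the decomposition
  (\<open>H_ideal_decomposition\<close>).

  That \<open>C(I)\<close> is an \<open>H\<close>-submodule (\<open>centralizer_H_submodule\<close>) holds over any Hopf algebra: for
  \<open>b \<in> C(I)\<close> and \<open>a \<in> I\<close>, coassociativity and the antipode axiom give, with summation understood,
  \<open>[h b, a] = [h\<^sub>1 b, h\<^sub>2 S(h\<^sub>3) a] = h\<^sub>1 [b, S(h\<^sub>2) a]\<close>, and this is zero because \<open>S(h\<^sub>2) a \<in> I\<close>.

  That \<open>C(I)\<close> is a complement (\<open>semisimple_ideal_complement\<close>) is where characteristic \<open>0\<close> and
  semisimplicity enter. Let \<open>I\<^sup>\<bottom>\<close> be orthogonal to \<open>I\<close> for the Killing form. The Killing form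
  vanishes on the ideal \<open>I \<inter> I\<^sup>\<bottom>\<close>, which is therefore solvable by Cartan's criterion
  (\<open>solvable_if_killing_zero\<close>), hence zero. So \<open>B = I + I\<^sup>\<bottom>\<close>, and \<open>[I\<^sup>\<bottom>, I] \<subseteq> I \<inter> I\<^sup>\<bottom> = 0\<close>.

  Cartan's criterion comes down to a perfect subalgebra \<open>N\<close> on which the Killing form vanishes. Let
  \<open>x \<in> N\<close>, let \<open>d\<^sub>1, \<dots>, d\<^sub>n\<close> be the eigenvalues of \<open>ad x\<close> in an algebraic closure \<open>K\<close>, and let
  \<open>f : K \<rightarrow> \<rat>\<close> be \<open>\<rat>\<close>-linear. Let \<open>Y\<close> act on the generalized eigenspace of \<open>ad x\<close> for \<open>d\<close> as the
  scalar \<open>f(d)\<close>. Commuting with \<open>Y\<close> multiplies the part of \<open>ad b\<close> of weight \<open>d\<^sub>i - d\<^sub>j\<close> by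
  \<open>f(d\<^sub>j - d\<^sub>i)\<close>, and every such part inherits from \<open>ad b\<close> the orthogonality to \<open>ad a\<close>, for
  \<open>a, b \<in> N\<close>. So \<open>tr ([ad a, ad b] Y) = tr (ad a [ad b, Y]) = 0\<close>, and as \<open>x\<close> is a sum of brackets,
  \<open>0 = tr (ad x Y) = \<Sum>\<^sub>i d\<^sub>i f(d\<^sub>i)\<close>. Applying \<open>f\<close> gives \<open>\<Sum>\<^sub>i f(d\<^sub>i)\<^sup>2 = 0\<close> in \<open>\<rat>\<close>, so all \<open>f(d\<^sub>i)\<close>
  vanish, for every \<open>f\<close>, and \<open>ad x\<close> is nilpotent (\<open>nilpotent_if_orthogonal\<close>). By Engel's theorem
  (\<open>engel\<close>) a perfect \<open>N\<close> of this kind is zero. Only the matrices of \<open>ad\<close> are extended to \<open>K\<close>, not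
  the Lie algebra.
\<close>

section \<open>Ideals of Lie algebras and the theorem of Engel\<close>

context lie_algebra
begin

lemma bracket_add_left: "bracket (x + y) z = bracket x z + bracket y z"
  using module_hom.add[OF bracket_linear_left[folded module_hom_iff_linear]] .

lemma bracket_add_right: "bracket z (x + y) = bracket z x + bracket z y"
  using module_hom.add[OF bracket_linear_right[folded module_hom_iff_linear]] .

lemma bracket_scale_left: "bracket (scale c x) z = scale c (bracket x z)"
  using module_hom.scale[OF bracket_linear_left[folded module_hom_iff_linear]] .

lemma bracket_scale_right: "bracket z (scale c x) = scale c (bracket z x)"
  using module_hom.scale[OF bracket_linear_right[folded module_hom_iff_linear]] .

lemma bracket_zero_left [simp]: "bracket 0 z = 0"
  using module_hom.zero[OF bracket_linear_left[folded module_hom_iff_linear]] .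

lemma bracket_zero_right [simp]: "bracket z 0 = 0"
  using module_hom.zero[OF bracket_linear_right[folded module_hom_iff_linear]] .

lemma bracket_minus_right: "bracket z (- x) = - bracket z x"
  using module_hom.neg[OF bracket_linear_right[folded module_hom_iff_linear]] .

lemma bracket_diff_left: "bracket (x - y) z = bracket x z - bracket y z"
  using module_hom.diff[OF bracket_linear_left[folded module_hom_iff_linear]] .

lemma bracket_anticomm: "bracket y x = - bracket x y"
proof -
  have "bracket x y + bracket y x = 0"
    using bracket_self[of "x + y"] bracket_self[of x] bracket_self[of y]
    unfolding bracket_add_left bracket_add_right by (simp add: add.commute[of "bracket y x"])
  then show ?thesis by (metis add_eq_0_iff)
qed

lemma bracket_bracket: "bracket (bracket x y) z = bracket x (bracket y z) - bracket y (bracket x z)"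
proof -
  have "bracket (bracket x y) z = - bracket z (bracket x y)"
    by (rule bracket_anticomm)
  also have "\<dots> = bracket x (bracket y z) + bracket y (bracket z x)"
    using jacobi[of x y z] by (simp add: eq_neg_iff_add_eq_0 neg_eq_iff_add_eq_0 add.commute)
  also have "bracket y (bracket z x) = - bracket y (bracket x z)"
    by (metis bracket_anticomm bracket_minus_right)
  finally show ?thesis by simp
qed

lemma bracket_space_subset:
  assumes "subspace V" "\<And>x y. x \<in> L \<Longrightarrow> y \<in> M \<Longrightarrow> bracket x y \<in> V"
  shows "bracket_space L M \<subseteq> V"
  unfolding bracket_space_def using assms by (intro span_minimal) auto

lemma bracket_in_bracket_space: "x \<in> L \<Longrightarrow> y \<in> M \<Longrightarrow> bracket x y \<in> bracket_space L M"
  unfolding bracket_space_def by (intro span_base) auto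

text \<open>A line can be added to a subalgebra that normalizes it, because \<open>[z, z] = 0\<close>.\<close>

lemma lie_subalgebra_insert:
  assumes M: "lie_subalgebra M" and z: "\<And>m. m \<in> M \<Longrightarrow> bracket m z \<in> M"
  shows "lie_subalgebra (span (insert z M))"
proof -
  have sM: "subspace M" and cl: "\<And>x y. x \<in> M \<Longrightarrow> y \<in> M \<Longrightarrow> bracket x y \<in> M"
    using M by (auto simp: lie_subalgebra_def)
  have M_sub: "M \<subseteq> span (insert z M)" by (auto intro: span_base)
  have dec: "\<exists>c m. m \<in> M \<and> x = scale c z + m" if x: "x \<in> span (insert z M)" for x
    using x unfolding span_insert by (force simp: span_eq_iff[THEN iffD2, OF sM] algebra_simps)
  have "bracket x y \<in> M" if x: "x \<in> span (insert z M)" and y: "y \<in> span (insert z M)" for x y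
  proof -
    obtain c m where m: "m \<in> M" and xe: "x = scale c z + m" using dec[OF x] by blast
    obtain d n where n: "n \<in> M" and ye: "y = scale d z + n" using dec[OF y] by blast
    have "bracket z n \<in> M"
      using z[OF n] bracket_anticomm[of z n] subspace_neg[OF sM] by simp
    then show ?thesis
      unfolding xe ye
      using m n z cl
      by (auto simp: bracket_add_left bracket_add_right bracket_scale_left bracket_scale_right
            bracket_self intro!: subspace_add[OF sM] subspace_scale[OF sM])
  qed
  then show ?thesis using M_sub by (auto simp: lie_subalgebra_def)
qed

definition centralizer :: "'b set \<Rightarrow> 'b set" where
  "centralizer I = {x. \<forall>y\<in>I. bracket x y = 0}"

lemma centralizer_lie_ideal:
  assumes I: "lie_ideal I UNIV"
  shows "lie_ideal (centralizer I) UNIV"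
proof -
  have "bracket (bracket x y) z = 0" if "y \<in> centralizer I" "z \<in> I" for x y z
    using that I by (auto simp: bracket_bracket centralizer_def lie_ideal_def)
  then show ?thesis
    unfolding lie_ideal_def subspace_def
    by (auto simp: centralizer_def bracket_add_left bracket_scale_left)
qed

lemma lie_ideal_Int:
  "lie_ideal I L \<Longrightarrow> lie_ideal I' L \<Longrightarrow> lie_ideal (I \<inter> I') L"
  by (auto simp: lie_ideal_def subspace_inter)

end

locale finite_dimensional_lie_algebra =
  lie_algebra scale bracket + finite_dimensional_vector_space scale Basis
  for scale :: "'k::field \<Rightarrow> 'b::ab_group_add \<Rightarrow> 'b"
    and bracket :: "'b \<Rightarrow> 'b \<Rightarrow> 'b"
    and Basis :: "'b set"
begin

lemma maximal_subspace_exists: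
  assumes "P W" and P: "\<And>V. P V \<Longrightarrow> subspace V"
  obtains V where "P V" "\<And>V'. P V' \<Longrightarrow> V \<subseteq> V' \<Longrightarrow> V' = V"
proof -
  have "\<exists>V. P V \<and> (\<forall>V'. P V' \<longrightarrow> dim V' \<le> dim V)"
    by (rule ex_has_greatest_nat[where b = "Suc dimension" and f = dim and k = W])
       (use assms(1) dim_subset_UNIV in \<open>auto simp: less_Suc_eq_le\<close>)
  then obtain V where V: "P V" "\<forall>V'. P V' \<longrightarrow> dim V' \<le> dim V" by blast
  have "V' = V" if "P V'" "V \<subseteq> V'" for V'
    using subspace_dim_equal[of V V'] that V P by auto
  then show ?thesis using that V(1) by blast
qed

lemma dim_less: "subspace V \<Longrightarrow> subspace V' \<Longrightarrow> V \<subset> V' \<Longrightarrow> dim V < dim V'"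
  using dim_psubset by (metis span_eq_iff)

text \<open>
  Engel's theorem in relative form: \<open>M\<close> has a common null vector on \<open>U / W\<close>. The induction on
  \<open>dim M\<close> uses it twice for a maximal proper subalgebra \<open>V\<close>. Applied to the action of \<open>V\<close> on \<open>M / V\<close>
  it yields \<open>z \<notin> V\<close> normalizing \<open>V\<close>, so \<open>M = V + k z\<close> by maximality. Applied to \<open>U / W\<close> it shows that
  the space of vectors which \<open>V\<close> sends into \<open>W\<close> is larger than \<open>W\<close>; \<open>z\<close> preserves this space and
  acts on it nilpotently.
\<close>

lemma engel:
  assumes "lie_subalgebra M"
    and "\<And>x. x \<in> M \<Longrightarrow> \<exists>k. \<forall>y. (bracket x ^^ k) y = 0"
    and "subspace U" "subspace W" "W \<subset> U"
    and "\<And>m u. m \<in> M \<Longrightarrow> u \<in> U \<Longrightarrow> bracket m u \<in> U"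
    and "\<And>m u. m \<in> M \<Longrightarrow> u \<in> W \<Longrightarrow> bracket m u \<in> W"
  shows "\<exists>u\<in>U - W. \<forall>m\<in>M. bracket m u \<in> W"
  using assms
proof (induction "dim M" arbitrary: M U W rule: less_induct)
  case less
  note nil = less.prems(2) and sU = less.prems(3) and sW = less.prems(4)
    and WU = less.prems(5) and MU = less.prems(6) and MW = less.prems(7)
  have sM: "subspace M" and clM: "\<And>x y. x \<in> M \<Longrightarrow> y \<in> M \<Longrightarrow> bracket x y \<in> M"
    using less.prems(1) by (auto simp: lie_subalgebra_def)
  show ?case
  proof (cases "M = {0}")
    case True
    then show ?thesis using WU subspace_0[OF sW] by auto
  next
    case False
    define proper where "proper V \<longleftrightarrow> lie_subalgebra V \<and> V \<subset> M" for V
    have "proper {0}"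
      using False subspace_0[OF sM] by (auto simp: proper_def lie_subalgebra_def)
    then obtain V where V: "proper V" and max: "\<And>V'. proper V' \<Longrightarrow> V \<subseteq> V' \<Longrightarrow> V' = V"
      by (rule maximal_subspace_exists[of proper]) (auto simp: proper_def lie_subalgebra_def)
    have subV: "lie_subalgebra V" and VM: "V \<subset> M" and sV: "subspace V"
      and clV: "\<And>x y. x \<in> V \<Longrightarrow> y \<in> V \<Longrightarrow> bracket x y \<in> V"
      using V by (auto simp: proper_def lie_subalgebra_def)
    have dimV: "dim V < dim M" using dim_less[OF sV sM VM] .
    have "\<exists>z\<in>M - V. \<forall>m\<in>V. bracket m z \<in> V"
      by (rule less.hyps[OF dimV subV]) (use nil VM clM clV sM sV in auto)
    then obtain z where z: "z \<in> M" "z \<notin> V" and zV: "\<And>m. m \<in> V \<Longrightarrow> bracket m z \<in> V"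
      by blast
    let ?V' = "span (insert z V)"
    have sub': "lie_subalgebra ?V'" by (rule lie_subalgebra_insert[OF subV zV])
    have V'M: "?V' \<subseteq> M" using z VM by (intro span_minimal sM) auto
    have "\<not> proper ?V'"
      using max[of ?V'] z by (auto intro: span_base)
    then have M_eq: "M = ?V'" using sub' V'M by (auto simp: proper_def)
    define U' where "U' = {u \<in> U. \<forall>m\<in>V. bracket m u \<in> W}"
    have sU': "subspace U'"
      unfolding subspace_def U'_def
      using sU sW
      by (auto simp: bracket_add_right bracket_scale_right subspace_0 subspace_add subspace_scale)
    have "\<exists>u\<in>U - W. \<forall>m\<in>V. bracket m u \<in> W"
      by (rule less.hyps[OF dimV subV _ sU sW WU]) (use nil VM MU MW in auto)
    then obtain u where u: "u \<in> U'" "u \<notin> W" by (auto simp: U'_def)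
    have zU': "bracket z v \<in> U'" if v: "v \<in> U'" for v
    proof -
      have "bracket m (bracket z v) \<in> W" if m: "m \<in> V" for m
      proof -
        have "bracket m (bracket z v) = bracket (bracket m z) v + bracket z (bracket m v)"
          by (simp add: bracket_bracket)
        moreover have "bracket (bracket m z) v \<in> W" using zV[OF m] v by (auto simp: U'_def)
        moreover have "bracket z (bracket m v) \<in> W"
          using m v z(1) MW by (auto simp: U'_def)
        ultimately show ?thesis using subspace_add[OF sW] by simp
      qed
      then show ?thesis using v MU[OF z(1)] by (auto simp: U'_def)
    qed
    have pow: "(bracket z ^^ k) u \<in> U'" for k
      by (induction k) (use u zU' in auto)
    obtain k where "(bracket z ^^ k) u = 0" using nil[OF z(1)] by blast
    then have "(bracket z ^^ k) u \<in> W" using subspace_0[OF sW] by simp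
    moreover have "(bracket z ^^ 0) u \<notin> W" using u(2) by simp
    \<comment> \<open>The last iterate outside \<open>W\<close> is sent into \<open>W\<close> by \<open>V\<close> and by \<open>z\<close>.\<close>
    ultimately obtain k where k: "(bracket z ^^ k) u \<notin> W" "(bracket z ^^ Suc k) u \<in> W"
      using ex_least_nat_less[of "\<lambda>k. (bracket z ^^ k) u \<in> W" k] by blast
    let ?v = "(bracket z ^^ k) u"
    have "M \<subseteq> {m. bracket m ?v \<in> W}"
      unfolding M_eq
    proof (rule span_minimal)
      show "insert z V \<subseteq> {m. bracket m ?v \<in> W}"
        using pow[of k] k by (auto simp: U'_def)
      show "subspace {m. bracket m ?v \<in> W}"
        unfolding subspace_def using sW
        by (auto simp: bracket_add_left bracket_scale_left subspace_0 subspace_add subspace_scale)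
    qed
    then show ?thesis using k(1) pow[of k] by (auto simp: U'_def)
  qed
qed

text \<open>
  For a maximal proper ideal \<open>V\<close> of \<open>N\<close>, Engel's theorem on \<open>N / V\<close> gives \<open>u \<notin> V\<close> with
  \<open>[N, u] \<subseteq> V\<close>. Then \<open>N = V + k u\<close>, so \<open>[N, N] \<subseteq> V\<close>, and \<open>N\<close> is not perfect.
\<close>

lemma perfect_nilpotent_trivial:
  assumes N: "lie_subalgebra N"
    and nil: "\<And>x. x \<in> N \<Longrightarrow> \<exists>k. \<forall>y. (bracket x ^^ k) y = 0"
    and perfect: "bracket_space N N = N"
  shows "N = {0}"
proof (rule ccontr)
  assume nz: "N \<noteq> {0}"
  have sN: "subspace N" and clN: "\<And>x y. x \<in> N \<Longrightarrow> y \<in> N \<Longrightarrow> bracket x y \<in> N"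
    using N by (auto simp: lie_subalgebra_def)
  define proper where "proper V \<longleftrightarrow> lie_ideal V N \<and> V \<noteq> N" for V
  have "proper {0}"
    using nz subspace_0[OF sN] by (auto simp: proper_def lie_ideal_def)
  then obtain V where V: "proper V" and max: "\<And>V'. proper V' \<Longrightarrow> V \<subseteq> V' \<Longrightarrow> V' = V"
    by (rule maximal_subspace_exists[of proper]) (auto simp: proper_def lie_ideal_def)
  have sV: "subspace V" and VN: "V \<subset> N" and clV: "\<And>x y. x \<in> N \<Longrightarrow> y \<in> V \<Longrightarrow> bracket x y \<in> V"
    using V by (auto simp: proper_def lie_ideal_def)
  obtain u where u: "u \<in> N" "u \<notin> V" and uV: "\<And>m. m \<in> N \<Longrightarrow> bracket m u \<in> V"
    using engel[OF N nil sN sV VN clN clV] by blast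
  let ?V' = "span (insert u V)"
  have V'N: "?V' \<subseteq> N" using u VN by (intro span_minimal sN) auto
  have br: "bracket m x \<in> V" if m: "m \<in> N" and x: "x \<in> ?V'" for m x
  proof -
    have "?V' \<subseteq> {x. bracket m x \<in> V}"
    proof (rule span_minimal)
      show "insert u V \<subseteq> {x. bracket m x \<in> V}" using uV clV m by auto
      show "subspace {x. bracket m x \<in> V}"
        unfolding subspace_def using sV
        by (auto simp: bracket_add_right bracket_scale_right subspace_0 subspace_add subspace_scale)
    qed
    then show ?thesis using x by auto
  qed
  have V_sub: "V \<subseteq> ?V'" by (auto intro: span_base)
  have "lie_ideal ?V' N" using br V_sub V'N by (auto simp: lie_ideal_def)
  moreover have "?V' \<noteq> V" using u(2) by (auto intro: span_base)
  ultimately have "?V' = N" using max[of ?V'] V_sub by (auto simp: proper_def)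
  then have "bracket_space N N \<subseteq> V" using br sV by (intro bracket_space_subset) auto
  then show False using perfect VN by auto
qed

end

section \<open>Trace, commutator and triangularization by eigenvalue blocks\<close>

definition mtrace :: "'a::comm_ring_1 mat \<Rightarrow> 'a" where
  "mtrace A = (\<Sum>i<dim_row A. A $$ (i, i))"

lemma mtrace_mult:
  assumes "A \<in> carrier_mat n m" "B \<in> carrier_mat m n"
  shows "mtrace (A * B) = (\<Sum>i<n. \<Sum>j<m. A $$ (i, j) * B $$ (j, i))"
  using assms by (auto simp: mtrace_def scalar_prod_def atLeast0LessThan intro!: sum.cong)

lemma mtrace_comm:
  assumes "A \<in> carrier_mat n m" "B \<in> carrier_mat m n"
  shows "mtrace (A * B) = mtrace (B * A)"
  unfolding mtrace_mult[OF assms] mtrace_mult[OF assms(2,1)]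
  by (subst sum.swap) (simp add: mult.commute)

lemma mtrace_add:
  assumes "A \<in> carrier_mat n n" "B \<in> carrier_mat n n"
  shows "mtrace (A + B) = mtrace A + mtrace B"
  using assms by (auto simp: mtrace_def sum.distrib)

lemma mtrace_diff:
  assumes "A \<in> carrier_mat n n" "B \<in> carrier_mat n n"
  shows "mtrace (A - B) = mtrace A - mtrace B"
  using assms by (auto simp: mtrace_def sum_subtractf)

lemma mtrace_smult:
  assumes "A \<in> carrier_mat n n"
  shows "mtrace (c \<cdot>\<^sub>m A) = c * mtrace A"
  using assms by (auto simp: mtrace_def sum_distrib_left)

lemma mtrace_similar:
  assumes "similar_mat_wit A B P Q"
  shows "mtrace A = mtrace B"
proof -
  define n where "n = dim_row A"
  note D = similar_mat_witD[OF n_def assms]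
  note Q = D(2) and A = D(3) and c = D(4-7)
  have "mtrace A = mtrace (Q * (P * B))"
    by (subst A, rule mtrace_comm[of _ n n]) (use c in auto)
  also have "Q * (P * B) = (Q * P) * B" using c by (intro assoc_mult_mat[symmetric]) auto
  finally show ?thesis using Q c by simp
qed

definition commutator :: "'a::comm_ring_1 mat \<Rightarrow> 'a mat \<Rightarrow> 'a mat" where
  "commutator A B = A * B - B * A"

lemma commutator_carrier [simp, intro]:
  "A \<in> carrier_mat n n \<Longrightarrow> B \<in> carrier_mat n n \<Longrightarrow> commutator A B \<in> carrier_mat n n"
  by (auto simp: commutator_def)

lemma commutator_pow_carrier [simp, intro]:
  "A \<in> carrier_mat n n \<Longrightarrow> B \<in> carrier_mat n n \<Longrightarrow> (commutator A ^^ k) B \<in> carrier_mat n n"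
  by (induction k) auto

text \<open>
  The sum of a diagonal matrix and a strictly upper triangular one that commutes with it. This much
  of a Jordan normal form suffices below.
\<close>

definition split_triangular :: "'a::zero mat \<Rightarrow> bool" where
  "split_triangular J \<longleftrightarrow> (\<forall>i<dim_row J. \<forall>j<dim_row J.
     J $$ (i, j) \<noteq> 0 \<longrightarrow> i = j \<or> i < j \<and> J $$ (i, i) = J $$ (j, j))"

lemma eigenvector_first_similar:
  fixes A :: "'a::alg_closed_field mat"
  assumes A: "A \<in> carrier_mat (Suc n) (Suc n)"
  shows "\<exists>l r Y. r \<in> carrier_mat 1 n \<and> Y \<in> carrier_mat n n \<and>
    similar_mat A (four_block_mat (mat 1 1 (\<lambda>_. l)) r (0\<^sub>m n 1) Y)"
proof -
  let ?n = "Suc n"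
  have "Polynomial.degree (char_poly A) > 0" using degree_monic_char_poly[OF A] by simp
  then obtain l where "poly (char_poly A) l = 0" using alg_closed_imp_poly_has_root by blast
  then have "eigenvalue A l" using eigenvalue_root_char_poly[OF A] by simp
  then obtain v where v: "v \<in> carrier_vec ?n" "v \<noteq> 0\<^sub>v ?n" and Xv: "A *\<^sub>v v = l \<cdot>\<^sub>v v"
    using A by (auto simp: eigenvalue_def eigenvector_def)
  have "\<exists>k<?n. v $ k \<noteq> 0"
  proof (rule ccontr)
    assume "\<not> ?thesis"
    then have "v = 0\<^sub>v ?n" using v(1) by (intro eq_vecI) auto
    then show False using v(2) by simp
  qed
  then obtain k where k: "k < ?n" "v $ k \<noteq> 0" by blast
  \<comment> \<open>Replace the \<open>k\<close>-th unit vector by \<open>v\<close> and move it to the first place.\<close>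
  define \<sigma> where "\<sigma> i = (if i = 0 then k else if i = k then 0 else i)" for i :: nat
  have \<sigma>: "\<sigma> (\<sigma> i) = i" "i < ?n \<Longrightarrow> \<sigma> i < ?n" for i
    using k by (auto simp: \<sigma>_def)
  have \<sigma>_eq: "i = \<sigma> j \<longleftrightarrow> j = \<sigma> i" for i j using \<sigma>(1) by metis
  define W where "W = mat ?n ?n (\<lambda>(i, j). if j = 0 then v $ i else if j = \<sigma> i then 1 else 0)"
  have W: "W \<in> carrier_mat ?n ?n" by (simp add: W_def)
  have Wrow: "(W *\<^sub>v w) $ i = v $ i * w $ 0 + (if \<sigma> i = 0 then 0 else w $ \<sigma> i)"
    if w: "w \<in> carrier_vec ?n" and i: "i < ?n" for w i
  proof -
    have "(W *\<^sub>v w) $ i = (\<Sum>j\<in>{0..<?n}. W $$ (i, j) * w $ j)"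
      using w i W by (auto simp: scalar_prod_def)
    also have "\<dots> = W $$ (i, 0) * w $ 0 + (\<Sum>j\<in>{1..<?n}. W $$ (i, j) * w $ j)"
      by (simp add: sum.atLeast_Suc_lessThan)
    also have "(\<Sum>j\<in>{1..<?n}. W $$ (i, j) * w $ j) = (\<Sum>j\<in>{1..<?n}. if j = \<sigma> i then w $ j else 0)"
      using i by (intro sum.cong) (auto simp: W_def)
    also have "\<dots> = (if \<sigma> i = 0 then 0 else w $ \<sigma> i)"
      using \<sigma>(2)[OF i] by (auto simp: sum.delta')
    finally show ?thesis using i by (simp add: W_def)
  qed
  have "det W \<noteq> 0"
  proof
    assume "det W = 0"
    then obtain w where w: "w \<in> carrier_vec ?n" "w \<noteq> 0\<^sub>v ?n" and Ww: "W *\<^sub>v w = 0\<^sub>v ?n"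
      using det_0_iff_vec_prod_zero_field[OF W] by auto
    have "\<sigma> k = 0" by (simp add: \<sigma>_def)
    then have "v $ k * w $ 0 = 0" using Wrow[OF w(1) k(1)] Ww k by simp
    then have w0: "w $ 0 = 0" using k by simp
    have "w $ j = 0" if j: "j < ?n" for j
      using Wrow[OF w(1) \<sigma>(2)[OF j]] Ww w0 \<sigma> j by (cases "j = 0") auto
    then have "w = 0\<^sub>v ?n" using w(1) by (intro eq_vecI) auto
    then show False using w(2) by simp
  qed
  from det_non_zero_imp_unit[OF W this, of "()"]
  obtain Q where Q: "Q \<in> carrier_mat ?n ?n" and QW: "Q * W = 1\<^sub>m ?n" and WQ: "W * Q = 1\<^sub>m ?n"
    unfolding Units_def ring_mat_simps by auto
  define Z where "Z = Q * A * W"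
  have Z: "Z \<in> carrier_mat ?n ?n" using Q A W by (simp add: Z_def)
  have "A = W * Z * Q"
  proof -
    have "W * Z * Q = (W * Q) * A * (W * Q)"
      unfolding Z_def using W Q A by (simp add: assoc_mult_mat[of _ ?n ?n _ ?n _ ?n])
    then show ?thesis using WQ A by simp
  qed
  then have sim: "similar_mat A Z"
    using A Z W Q QW WQ by (intro similar_matI[of _ _ W Q ?n]) auto
  have Wcol: "W *\<^sub>v unit_vec ?n 0 = v"
    using Wrow[of "unit_vec ?n 0"] v(1) W \<sigma>(2) by (intro eq_vecI) (auto simp: Wrow)
  have "Z *\<^sub>v unit_vec ?n 0 = Q *\<^sub>v (A *\<^sub>v (W *\<^sub>v unit_vec ?n 0))"
    unfolding Z_def using W Q A
    by (simp add: assoc_mult_mat_vec[of _ ?n ?n _ ?n])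
  also have "\<dots> = l \<cdot>\<^sub>v (Q *\<^sub>v (W *\<^sub>v unit_vec ?n 0))"
    unfolding Wcol Xv using Q v(1) by (simp add: mult_mat_vec)
  also have "Q *\<^sub>v (W *\<^sub>v unit_vec ?n 0) = unit_vec ?n 0"
    using W Q QW by (simp add: assoc_mult_mat_vec[of _ ?n ?n _ ?n, symmetric])
  finally have Zcol: "Z *\<^sub>v unit_vec ?n 0 = l \<cdot>\<^sub>v unit_vec ?n 0" .
  have Zi0: "Z $$ (i, 0) = (if i = 0 then l else 0)" if i: "i < ?n" for i
  proof -
    have "(Z *\<^sub>v unit_vec ?n 0) $ i = Z $$ (i, 0)" using Z i by auto
    then show ?thesis unfolding Zcol using i by (cases "i = 0") (auto simp: unit_vec_def)
  qed
  obtain A1 A2 A3 A4 where split: "split_block Z 1 1 = (A1, A2, A3, A4)"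
    by (cases "split_block Z 1 1") auto
  have "Z = four_block_mat A1 A2 A3 A4" "A1 \<in> carrier_mat 1 1" "A2 \<in> carrier_mat 1 n"
    "A3 \<in> carrier_mat n 1" "A4 \<in> carrier_mat n n"
    using split_block[OF split, of n n] Z by auto
  moreover have "A1 = mat 1 1 (\<lambda>_. l)" "A3 = 0\<^sub>m n 1"
    using split Zi0 Z unfolding split_block_def Let_def by (auto intro!: eq_matI)
  ultimately show ?thesis using sim by blast
qed

text \<open>
  Conjugation by the unipotent block matrix with upper right block \<open>s\<close> changes the row \<open>r\<close> into
  \<open>r - l s + s J\<close>. The entries of \<open>r\<close> that couple \<open>l\<close> to other eigenvalues can be removed, because
  \<open>J - l\<close> is triangular and invertible on the corresponding columns.
\<close>

lemma clear_row_similar: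
  fixes J :: "'a::field mat"
  assumes J: "J \<in> carrier_mat n n" and st: "split_triangular J" and r: "r \<in> carrier_mat 1 n"
  shows "\<exists>r'. r' \<in> carrier_mat 1 n \<and> (\<forall>j<n. J $$ (j, j) \<noteq> l \<longrightarrow> r' $$ (0, j) = 0) \<and>
    similar_mat (four_block_mat (mat 1 1 (\<lambda>_. l)) r (0\<^sub>m n 1) J)
      (four_block_mat (mat 1 1 (\<lambda>_. l)) r' (0\<^sub>m n 1) J)"
proof -
  \<comment> \<open>Solve \<open>s (J - l) = - r\<close> at the columns \<open>j\<close> with \<open>J\<^sub>j\<^sub>j \<noteq> l\<close>, from left to right.\<close>
  define step where "step s j = (if J $$ (j, j) = l then 0 else
      - (r $$ (0, j) + (\<Sum>i<j. s i * J $$ (i, j))) / (J $$ (j, j) - l))" for s j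
  obtain s where s: "s j = step s j" for j
  proof -
    have "\<exists>s. \<forall>j. s j = step s j"
    proof -
      have ad: "adm_wf less_than step"
        unfolding adm_wf_def step_def by (auto intro!: sum.cong)
      have "wfrec less_than step j = step (wfrec less_than step) j" for j
        by (rule wfrec_fixpoint[OF wf_less_than ad, THEN fun_cong])
      then show ?thesis by blast
    qed
    then show ?thesis using that by blast
  qed
  define S where "S = mat 1 n (\<lambda>(_, j). s j)"
  define r' where "r' = r - l \<cdot>\<^sub>m S + S * J"
  have c: "S \<in> carrier_mat 1 n" "r' \<in> carrier_mat 1 n" "mat 1 1 (\<lambda>_. l) \<in> carrier_mat 1 1"
    using r J by (auto simp: S_def r'_def)
  have S_J: "(S * J) $$ (0, j) = (\<Sum>i<j. s i * J $$ (i, j)) + s j * J $$ (j, j)" if j: "j < n" for j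
  proof -
    have "(S * J) $$ (0, j) = (\<Sum>i\<in>{0..<n}. s i * J $$ (i, j))"
      using j J by (auto simp: S_def scalar_prod_def)
    also have "\<dots> = (\<Sum>i\<in>{..<Suc j}. s i * J $$ (i, j))"
    proof (intro sum.mono_neutral_right ballI)
      fix i assume "i \<in> {0..<n} - {..<Suc j}"
      then have "J $$ (i, j) = 0"
        using j J st by (force simp: split_triangular_def)
      then show "s i * J $$ (i, j) = 0" by simp
    qed (use j in auto)
    finally show ?thesis by simp
  qed
  have r'0: "r' $$ (0, j) = 0" if j: "j < n" and ne: "J $$ (j, j) \<noteq> l" for j
  proof -
    have "r' $$ (0, j) = r $$ (0, j) - l * s j + ((\<Sum>i<j. s i * J $$ (i, j)) + s j * J $$ (j, j))"
      using j r c J S_J[OF j] by (simp add: r'_def S_def)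
    also have "\<dots> = (r $$ (0, j) + (\<Sum>i<j. s i * J $$ (i, j))) + s j * (J $$ (j, j) - l)"
      by (simp add: algebra_simps)
    also have "s j * (J $$ (j, j) - l) = - (r $$ (0, j) + (\<Sum>i<j. s i * J $$ (i, j)))"
      by (subst s) (use ne in \<open>simp add: step_def\<close>)
    finally show ?thesis by simp
  qed
  let ?L = "mat 1 1 (\<lambda>_. l) :: 'a mat"
  let ?A = "four_block_mat ?L r (0\<^sub>m n 1) J"
  let ?B = "four_block_mat ?L r' (0\<^sub>m n 1) J"
  let ?P = "four_block_mat (1\<^sub>m 1) (- S) (0\<^sub>m n 1) (1\<^sub>m n)"
  let ?Q = "four_block_mat (1\<^sub>m 1) S (0\<^sub>m n 1) (1\<^sub>m n)"
  have mS: "- S \<in> carrier_mat 1 n" using c by simp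
  have one: "four_block_mat (1\<^sub>m 1) (0\<^sub>m 1 n) (0\<^sub>m n 1) (1\<^sub>m n) = (1\<^sub>m (1 + n) :: 'a mat)"
    by (simp add: four_block_one_mat)
  have SS: "S + - S = 0\<^sub>m 1 n" "- S + S = 0\<^sub>m 1 n" "- 0\<^sub>m n n + 1\<^sub>m n = (1\<^sub>m n :: 'a mat)"
    using c by auto
  have PQ: "?P * ?Q = 1\<^sub>m (1 + n)"
    unfolding one[symmetric]
    using c mS SS by (subst mult_four_block_mat[of _ 1 1 _ n _ n _ _ 1 _ n]) auto
  have QP: "?Q * ?P = 1\<^sub>m (1 + n)"
    unfolding one[symmetric]
    using c mS SS by (subst mult_four_block_mat[of _ 1 1 _ n _ n _ _ 1 _ n]) auto
  have LS: "?L * S = l \<cdot>\<^sub>m S"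
    using c by (intro eq_matI) (auto simp: scalar_prod_def S_def)
  have e1: "?L * S + (r' + - (S * J)) = r"
    unfolding LS r'_def using c r J by (intro eq_matI) auto
  have PB: "?P * ?B = four_block_mat ?L (r' + - (S * J)) (0\<^sub>m n 1) J"
    using c mS r J by (subst mult_four_block_mat[of _ 1 1 _ n _ n _ _ 1 _ n]) auto
  have "?P * ?B * ?Q = ?A"
    unfolding PB using c mS r J e1
    by (subst mult_four_block_mat[of _ 1 1 _ n _ n _ _ 1 _ n]) auto
  then have "similar_mat ?A ?B"
    using PQ QP c mS r J by (intro similar_matI[of _ _ ?P ?Q "1 + n"]) auto
  then show ?thesis using r'0 c by blast
qed

text \<open>
  By induction on the size: move an eigenvector to the front, bring the remaining block into the
  required form, and clear the first row.
\<close>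

lemma split_triangular_similar:
  fixes A :: "'a::alg_closed_field mat"
  assumes "A \<in> carrier_mat n n"
  shows "\<exists>J. J \<in> carrier_mat n n \<and> split_triangular J \<and> similar_mat A J"
  using assms
proof (induction n arbitrary: A)
  case 0
  then show ?case by (intro exI[of _ A]) (auto simp: split_triangular_def similar_mat_refl)
next
  case (Suc n)
  obtain l r Y where r: "r \<in> carrier_mat 1 n" and Y: "Y \<in> carrier_mat n n"
    and X_sim: "similar_mat A (four_block_mat (mat 1 1 (\<lambda>_. l)) r (0\<^sub>m n 1) Y)"
    using eigenvector_first_similar[OF Suc.prems] by blast
  obtain J where J: "J \<in> carrier_mat n n" "split_triangular J" and YJ: "similar_mat Y J"
    using Suc.IH[OF Y] by blast
  have L: "mat 1 1 (\<lambda>_. l) \<in> carrier_mat 1 1" by simp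
  obtain r1 where r1: "r1 \<in> carrier_mat 1 n"
    and sim1: "similar_mat (four_block_mat (mat 1 1 (\<lambda>_. l)) r (0\<^sub>m n 1) Y)
      (four_block_mat (mat 1 1 (\<lambda>_. l)) r1 (0\<^sub>m n 1) J)"
    using similar_mat_four_block_0_ex[OF similar_mat_refl[OF L] YJ r L Y] by blast
  obtain r' where r': "r' \<in> carrier_mat 1 n" "\<And>j. j < n \<Longrightarrow> J $$ (j, j) \<noteq> l \<Longrightarrow> r' $$ (0, j) = 0"
    and sim2: "similar_mat (four_block_mat (mat 1 1 (\<lambda>_. l)) r1 (0\<^sub>m n 1) J)
      (four_block_mat (mat 1 1 (\<lambda>_. l)) r' (0\<^sub>m n 1) J)"
    using clear_row_similar[OF J r1, of l] by blast
  let ?B = "four_block_mat (mat 1 1 (\<lambda>_. l)) r' (0\<^sub>m n 1) J"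
  have B: "?B \<in> carrier_mat (Suc n) (Suc n)"
    using four_block_carrier_mat[OF L J(1), of r' "0\<^sub>m n 1"] by simp
  have "split_triangular ?B"
    unfolding split_triangular_def
  proof (intro allI impI)
    fix i j assume ij: "i < dim_row ?B" "j < dim_row ?B" and nz: "?B $$ (i, j) \<noteq> 0"
    then have "i < Suc n" "j < Suc n" using B by auto
    then show "i = j \<or> i < j \<and> ?B $$ (i, i) = ?B $$ (j, j)"
      using nz J r' by (cases i; cases j) (auto simp: split_triangular_def)
  qed
  then show ?case
    using B similar_mat_trans[OF similar_mat_trans[OF X_sim sim1] sim2] by blast
qed

section \<open>Nilpotency from the orthogonality of commutators\<close>

text \<open>The operator \<open>E - \<mu>\<close> on sequences, where \<open>E\<close> is the shift.\<close>

definition shift_minus :: "'a::field \<Rightarrow> (nat \<Rightarrow> 'a) \<Rightarrow> nat \<Rightarrow> 'a" where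
  "shift_minus \<mu> \<tau> = (\<lambda>k. \<tau> (Suc k) - \<mu> * \<tau> k)"

lemma shift_minus_zero [simp]: "(shift_minus \<mu> ^^ m) (\<lambda>_. 0) = (\<lambda>_. 0)"
  by (induction m) (auto simp: shift_minus_def)

lemma shift_minus_commute: "shift_minus \<mu> (shift_minus \<nu> \<tau>) = shift_minus \<nu> (shift_minus \<mu> \<tau>)"
  by (auto simp: shift_minus_def algebra_simps)

lemma shift_minus_pow_commute:
  "(shift_minus \<mu> ^^ a) ((shift_minus \<nu> ^^ b) \<tau>) = (shift_minus \<nu> ^^ b) ((shift_minus \<mu> ^^ a) \<tau>)"
proof (induction a)
  case (Suc a)
  have "shift_minus \<mu> ((shift_minus \<nu> ^^ b) \<tau>') = (shift_minus \<nu> ^^ b) (shift_minus \<mu> \<tau>')" for \<tau>'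
    by (induction b) (simp_all add: shift_minus_commute[of \<mu>])
  then show ?case using Suc by simp
qed simp

lemma shift_minus_pow_sum:
  "(shift_minus \<mu> ^^ m) (\<lambda>k. \<Sum>x\<in>S. \<tau> x k) = (\<lambda>k. \<Sum>x\<in>S. (shift_minus \<mu> ^^ m) (\<tau> x) k)"
  by (induction m) (auto simp: shift_minus_def sum_subtractf sum_distrib_left)

text \<open>
  A sequence killed by \<open>E - \<mu>\<close>, where \<open>E\<close> is the shift, is geometric with ratio \<open>\<mu>\<close>, and \<open>E - \<nu>\<close>
  acts on it as the nonzero scalar \<open>\<mu> - \<nu>\<close>. Higher powers follow by induction, as the operators
  commute.
\<close>

lemma shift_minus_kernels_disjoint:
  assumes "\<mu> \<noteq> \<nu>" "(shift_minus \<mu> ^^ a) \<tau> = (\<lambda>_. 0)" "(shift_minus \<nu> ^^ b) \<tau> = (\<lambda>_. 0)"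
  shows "\<tau> = (\<lambda>_. 0)"
  using assms(2,3)
proof (induction a arbitrary: \<tau>)
  case (Suc a)
  have "shift_minus \<mu> \<tau> = (\<lambda>_. 0)"
  proof (rule Suc.IH)
    show "(shift_minus \<mu> ^^ a) (shift_minus \<mu> \<tau>) = (\<lambda>_. 0)"
      using Suc.prems(1) by (simp add: funpow_swap1)
    show "(shift_minus \<nu> ^^ b) (shift_minus \<mu> \<tau>) = (\<lambda>_. 0)"
      using shift_minus_pow_commute[of b \<nu> 1 \<mu> \<tau>] Suc.prems(2) shift_minus_zero[of 1 \<mu>] by simp
  qed
  then have geo: "\<tau> (Suc k) = \<mu> * \<tau> k" for k
    by (auto simp: shift_minus_def fun_eq_iff)
  have "(shift_minus \<nu> ^^ m) \<tau> = (\<lambda>k. (\<mu> - \<nu>) ^ m * \<tau> k)" for m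
  proof (induction m)
    case (Suc m)
    then show ?case by (auto simp: shift_minus_def geo algebra_simps)
  qed simp
  then have "(\<mu> - \<nu>) ^ b * \<tau> k = 0" for k
    using Suc.prems(2) by (auto simp: fun_eq_iff)
  then show ?case using assms(1) by auto
qed simp

text \<open>
  Generalized eigenvectors of the shift for different eigenvalues are linearly independent. This
  separates the weights in a sequence of traces \<open>tr (A (ad J)\<^sup>k B)\<close> without interpolation polynomials.
\<close>

lemma shift_minus_kernels_independent:
  assumes "finite S" "\<And>\<mu>. \<mu> \<in> S \<Longrightarrow> (shift_minus \<mu> ^^ m) (\<tau> \<mu>) = (\<lambda>_. 0)"
    and "(\<lambda>k. \<Sum>\<mu>\<in>S. \<tau> \<mu> k) = (\<lambda>_. 0)" and "\<mu> \<in> S"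
  shows "\<tau> \<mu> = (\<lambda>_. 0)"
  using assms
proof (induction S arbitrary: \<tau> \<mu> rule: finite_induct)
  case (insert \<nu> S)
  let ?\<tau> = "\<lambda>\<mu>. (shift_minus \<nu> ^^ m) (\<tau> \<mu>)"
  have S: "\<tau> \<mu> = (\<lambda>_. 0)" if "\<mu> \<in> S" for \<mu>
  proof -
    have "(\<lambda>k. \<Sum>\<mu>\<in>insert \<nu> S. ?\<tau> \<mu> k) = (\<lambda>_. 0)"
      unfolding shift_minus_pow_sum[symmetric] insert.prems(2) by simp
    then have "(\<lambda>k. \<Sum>\<mu>\<in>S. ?\<tau> \<mu> k) = (\<lambda>_. 0)"
      using insert.hyps insert.prems(1)[of \<nu>] by simp
    moreover have "(shift_minus \<mu> ^^ m) (?\<tau> \<mu>) = (\<lambda>_. 0)" if "\<mu> \<in> S" for \<mu>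
      using that insert.prems(1)[of \<mu>] by (simp add: shift_minus_pow_commute[of _ \<mu>])
    ultimately have "?\<tau> \<mu> = (\<lambda>_. 0)" by (intro insert.IH[of ?\<tau>]) (use that in auto)
    then show ?thesis
      using shift_minus_kernels_disjoint[of \<nu> \<mu> m "\<tau> \<mu>" m] insert.prems(1)[of \<mu>] insert.hyps(2) that
      by auto
  qed
  then have "\<tau> \<nu> = (\<lambda>_. 0)"
    using insert.prems(2) insert.hyps by simp
  then show ?case using S insert.prems(3) by auto
qed simp

lemma commutator_index:
  assumes "A \<in> carrier_mat n n" "B \<in> carrier_mat n n" "i < n" "j < n"
  shows "commutator A B $$ (i, j) = (\<Sum>l<n. A $$ (i, l) * B $$ (l, j)) - (\<Sum>l<n. B $$ (i, l) * A $$ (l, j))"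
  using assms by (auto simp: commutator_def scalar_prod_def atLeast0LessThan)

text \<open>
  Linearity of \<open>(ad J)\<^sup>k\<close>, stated through entries: as \<^typ>\<open>'a mat\<close> contains matrices of all sizes,
  it has no zero and no finite sums.
\<close>

lemma commutator_pow_sum_index:
  assumes J: "J \<in> carrier_mat n n" and B: "B \<in> carrier_mat n n"
    and F: "\<And>x. x \<in> S \<Longrightarrow> F x \<in> carrier_mat n n"
    and sum: "\<And>i j. i < n \<Longrightarrow> j < n \<Longrightarrow> B $$ (i, j) = (\<Sum>x\<in>S. c x * F x $$ (i, j))"
    and ij: "i < n" "j < n"
  shows "(commutator J ^^ k) B $$ (i, j) = (\<Sum>x\<in>S. c x * (commutator J ^^ k) (F x) $$ (i, j))"
  using ij
proof (induction k arbitrary: i j)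
  case 0
  then show ?case using sum by simp
next
  case (Suc k)
  let ?B = "(commutator J ^^ k) B" and ?F = "\<lambda>x. (commutator J ^^ k) (F x)"
  have "commutator J ?B $$ (i, j) =
      (\<Sum>l<n. \<Sum>x\<in>S. c x * (J $$ (i, l) * ?F x $$ (l, j))) -
      (\<Sum>l<n. \<Sum>x\<in>S. c x * (?F x $$ (i, l) * J $$ (l, j)))"
    using Suc J B
    by (subst commutator_index[of _ n]) (auto simp: sum_distrib_left sum_distrib_right mult_ac)
  also have "\<dots> = (\<Sum>x\<in>S. c x * commutator J (?F x) $$ (i, j))"
    unfolding sum.swap[of _ S "{..<n}"]
    using Suc.prems J F
    by (auto simp: commutator_index[of _ n] sum_distrib_left right_diff_distrib sum_subtractf intro!: sum.cong)
  finally show ?case by simp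
qed

lemma mtrace_commutator_pow_sum:
  assumes A: "A \<in> carrier_mat n n" and J: "J \<in> carrier_mat n n" and B: "B \<in> carrier_mat n n"
    and F: "\<And>x. x \<in> S \<Longrightarrow> F x \<in> carrier_mat n n"
    and sum: "\<And>i j. i < n \<Longrightarrow> j < n \<Longrightarrow> B $$ (i, j) = (\<Sum>x\<in>S. c x * F x $$ (i, j))"
  shows "mtrace (A * (commutator J ^^ k) B) = (\<Sum>x\<in>S. c x * mtrace (A * (commutator J ^^ k) (F x)))"
proof -
  have "mtrace (A * (commutator J ^^ k) B) =
      (\<Sum>i<n. \<Sum>j<n. \<Sum>x\<in>S. c x * (A $$ (i, j) * (commutator J ^^ k) (F x) $$ (j, i)))"
    using A J B F sum
    by (subst mtrace_mult[of _ n n])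
       (auto simp: commutator_pow_sum_index[of J n B S F c] sum_distrib_left mult_ac intro!: sum.cong)
  also have "\<dots> = (\<Sum>i<n. \<Sum>x\<in>S. \<Sum>j<n. c x * (A $$ (i, j) * (commutator J ^^ k) (F x) $$ (j, i)))"
    by (intro sum.cong refl sum.swap)
  also have "\<dots> = (\<Sum>x\<in>S. \<Sum>i<n. \<Sum>j<n. c x * (A $$ (i, j) * (commutator J ^^ k) (F x) $$ (j, i)))"
    by (rule sum.swap)
  also have "\<dots> = (\<Sum>x\<in>S. c x * mtrace (A * (commutator J ^^ k) (F x)))"
    using A J F by (auto simp: mtrace_mult[of _ n n] sum_distrib_left intro!: sum.cong)
  finally show ?thesis .
qed

text \<open>
  The component of \<open>B\<close> in the \<open>\<mu>\<close>-eigenspace of the commutator with the diagonal of \<open>J\<close>.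
\<close>

definition weight_part :: "'a::field mat \<Rightarrow> 'a \<Rightarrow> 'a mat \<Rightarrow> 'a mat" where
  "weight_part J \<mu> B = mat (dim_row J) (dim_row J)
     (\<lambda>(i, j). if J $$ (i, i) - J $$ (j, j) = \<mu> then B $$ (i, j) else 0)"

lemma weight_part_carrier [simp, intro]:
  "J \<in> carrier_mat n n \<Longrightarrow> weight_part J \<mu> B \<in> carrier_mat n n"
  by (simp add: weight_part_def)

text \<open>
  On matrices of weight \<open>\<mu>\<close> for the diagonal of \<open>J\<close>, the operator \<open>ad J - \<mu>\<close> is the commutator with
  the strictly triangular part of \<open>J\<close>. That part has weight \<open>0\<close> and moves the support towards the
  upper right corner by at least one diagonal; there are fewer than \<open>2 n\<close> diagonals.
\<close>

lemma weight_part_nilpotent: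
  assumes J: "(J :: 'a::field mat) \<in> carrier_mat n n" and st: "split_triangular J"
  shows "((\<lambda>C. commutator J C - \<mu> \<cdot>\<^sub>m C) ^^ (2 * n)) (weight_part J \<mu> B) = 0\<^sub>m n n"
proof -
  define D where "D C = commutator J C - \<mu> \<cdot>\<^sub>m C" for C
  \<comment> \<open>Weight \<open>\<mu>\<close>, and no entries on the lowest \<open>k\<close> of the diagonals \<open>j - i = - n, 1 - n, \<dots>\<close>\<close>
  define supp where "supp k C \<longleftrightarrow> C \<in> carrier_mat n n \<and> (\<forall>i<n. \<forall>j<n. C $$ (i, j) \<noteq> 0 \<longrightarrow>
    J $$ (i, i) - J $$ (j, j) = \<mu> \<and> i + k \<le> j + n)" for k and C :: "'a mat"
  have tri: "i < l \<and> J $$ (i, i) = J $$ (l, l)" if "i < n" "l < n" "l \<noteq> i" "J $$ (i, l) \<noteq> 0" for i l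
    using st J that unfolding split_triangular_def by auto
  have step: "supp (Suc k) (D C)" if C: "supp k C" for k C
    unfolding supp_def
  proof (intro conjI allI impI)
    have Cc: "C \<in> carrier_mat n n" using C by (simp add: supp_def)
    have Cs: "J $$ (i, i) - J $$ (j, j) = \<mu>" "i + k \<le> j + n"
      if "i < n" "j < n" "C $$ (i, j) \<noteq> 0" for i j
      using C that by (auto simp: supp_def)
    show "D C \<in> carrier_mat n n" using Cc J by (auto simp: D_def)
    fix i j assume ij: "i < n" "j < n" and nz: "D C $$ (i, j) \<noteq> 0"
    have "D C $$ (i, j) = (\<Sum>l<n. J $$ (i, l) * C $$ (l, j)) - (\<Sum>l<n. C $$ (i, l) * J $$ (l, j))
        - \<mu> * C $$ (i, j)"
      using ij Cc J by (simp add: D_def commutator_index[of _ n])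
    also have "(\<Sum>l<n. J $$ (i, l) * C $$ (l, j)) =
        J $$ (i, i) * C $$ (i, j) + (\<Sum>l\<in>{..<n} - {i}. J $$ (i, l) * C $$ (l, j))"
      using ij by (intro sum.remove) auto
    also have "(\<Sum>l<n. C $$ (i, l) * J $$ (l, j)) =
        C $$ (i, j) * J $$ (j, j) + (\<Sum>l\<in>{..<n} - {j}. C $$ (i, l) * J $$ (l, j))"
      using ij by (intro sum.remove) auto
    finally have e: "D C $$ (i, j) = (J $$ (i, i) - J $$ (j, j) - \<mu>) * C $$ (i, j)
        + (\<Sum>l\<in>{..<n} - {i}. J $$ (i, l) * C $$ (l, j))
        - (\<Sum>l\<in>{..<n} - {j}. C $$ (i, l) * J $$ (l, j))"
      by (simp add: algebra_simps)
    have "(J $$ (i, i) - J $$ (j, j) - \<mu>) * C $$ (i, j) = 0"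
      using Cs[OF ij] by (cases "C $$ (i, j) = 0") auto
    then consider
        "(\<Sum>l\<in>{..<n} - {i}. J $$ (i, l) * C $$ (l, j)) \<noteq> 0"
      | "(\<Sum>l\<in>{..<n} - {j}. C $$ (i, l) * J $$ (l, j)) \<noteq> 0"
      using e nz by fastforce
    then have "J $$ (i, i) - J $$ (j, j) = \<mu> \<and> i + Suc k \<le> j + n"
    proof cases
      case 1
      then obtain l where "l < n" "l \<noteq> i" "J $$ (i, l) \<noteq> 0" "C $$ (l, j) \<noteq> 0"
        by (elim sum.not_neutral_contains_not_neutral) auto
      then show ?thesis using tri[of i l] Cs[of l j] ij by auto
    next
      case 2
      then obtain l where "l < n" "l \<noteq> j" "J $$ (l, j) \<noteq> 0" "C $$ (i, l) \<noteq> 0"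
        by (elim sum.not_neutral_contains_not_neutral) auto
      then show ?thesis using tri[of l j] Cs[of i l] ij by auto
    qed
    then show "J $$ (i, i) - J $$ (j, j) = \<mu>" "i + Suc k \<le> j + n" by auto
  qed
  have "supp k ((D ^^ k) (weight_part J \<mu> B))" for k
  proof (induction k)
    case 0
    show ?case using J by (auto simp: supp_def weight_part_def split: if_splits)
  next
    case (Suc k)
    then show ?case using step by simp
  qed
  then have s: "supp (2 * n) ((D ^^ (2 * n)) (weight_part J \<mu> B))" .
  have "(D ^^ (2 * n)) (weight_part J \<mu> B) = 0\<^sub>m n n"
    using s unfolding supp_def by (intro eq_matI) force+
  then show ?thesis unfolding D_def .
qed

text \<open>
  The sequence \<open>tr (A (ad J)\<^sup>k B)\<close> is the sum over the weights \<open>\<nu>\<close> of the sequences belonging to the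
  parts of \<open>B\<close> of weight \<open>\<nu>\<close>, which are killed by powers of \<open>E - \<nu>\<close>. These are independent,
  so each is zero if the sum is.
\<close>

lemma weight_part_orthogonal:
  assumes J: "J \<in> carrier_mat n n" and st: "split_triangular J"
    and A: "A \<in> carrier_mat n n" and B: "B \<in> carrier_mat n n"
    and orth: "\<And>k. mtrace (A * (commutator J ^^ k) B) = 0"
  shows "mtrace (A * weight_part J \<mu> B) = 0"
proof (cases "\<mu> \<in> (\<lambda>(i, j). J $$ (i, i) - J $$ (j, j)) ` ({..<n} \<times> {..<n})")
  case False
  then have "weight_part J \<mu> B = 0\<^sub>m n n"
    using J by (intro eq_matI) (auto simp: weight_part_def image_iff)
  then show ?thesis using A by (simp add: mtrace_def)
next
  case True
  define S where "S = (\<lambda>(i, j). J $$ (i, i) - J $$ (j, j)) ` ({..<n} \<times> {..<n})"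
  have S: "finite S" by (simp add: S_def)
  define \<tau> where "\<tau> \<nu> k = mtrace (A * (commutator J ^^ k) (weight_part J \<nu> B))" for \<nu> k
  have "(shift_minus \<nu> ^^ m) (\<lambda>k. mtrace (A * (commutator J ^^ k) C)) =
      (\<lambda>k. mtrace (A * (commutator J ^^ k) (((\<lambda>C. commutator J C - \<nu> \<cdot>\<^sub>m C) ^^ m) C)))"
    if "C \<in> carrier_mat n n" for \<nu> m C
    using that
  proof (induction m arbitrary: C)
    case (Suc m)
    let ?D = "\<lambda>C. commutator J C - \<nu> \<cdot>\<^sub>m C"
    have D: "?D C \<in> carrier_mat n n" using Suc.prems J by auto
    have "mtrace (A * (commutator J ^^ k) (?D C)) =
        mtrace (A * (commutator J ^^ Suc k) C) - \<nu> * mtrace (A * (commutator J ^^ k) C)" for k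
    proof -
      have "mtrace (A * (commutator J ^^ k) (?D C)) = (\<Sum>b\<in>UNIV.
          (if b then 1 else - \<nu>) * mtrace (A * (commutator J ^^ k) (if b then commutator J C else C)))"
        by (rule mtrace_commutator_pow_sum[OF A J D]) (use Suc.prems J in \<open>auto simp: UNIV_bool\<close>)
      then show ?thesis by (simp add: UNIV_bool funpow_swap1)
    qed
    then have "shift_minus \<nu> (\<lambda>k. mtrace (A * (commutator J ^^ k) C)) =
        (\<lambda>k. mtrace (A * (commutator J ^^ k) (?D C)))"
      by (simp add: shift_minus_def)
    then show ?case using Suc.IH[OF D] by (simp add: funpow_Suc_right del: funpow.simps)
  qed simp
  then have "(shift_minus \<nu> ^^ (2 * n)) (\<tau> \<nu>) = (\<lambda>k. mtrace (A * (commutator J ^^ k) (0\<^sub>m n n)))" for \<nu>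
    using weight_part_nilpotent[OF J st, of \<nu> B] J by (simp add: \<tau>_def[abs_def])
  moreover have "mtrace (A * (commutator J ^^ k) (0\<^sub>m n n)) = 0" for k
    using mtrace_commutator_pow_sum[OF A J, of "0\<^sub>m n n" "{} :: unit set" "\<lambda>_. B" "\<lambda>_. 0" k] by simp
  ultimately have killed: "(shift_minus \<nu> ^^ (2 * n)) (\<tau> \<nu>) = (\<lambda>_. 0)" for \<nu> by simp
  have "(\<Sum>\<nu>\<in>S. \<tau> \<nu> k) = 0" for k
  proof -
    have "mtrace (A * (commutator J ^^ k) B) = (\<Sum>\<nu>\<in>S. 1 * \<tau> \<nu> k)"
      unfolding \<tau>_def
    proof (rule mtrace_commutator_pow_sum[OF A J B])
      fix i j assume ij: "i < n" "j < n"
      then have "J $$ (i, i) - J $$ (j, j) \<in> S" by (auto simp: S_def)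
      then show "B $$ (i, j) = (\<Sum>x\<in>S. 1 * weight_part J x B $$ (i, j))"
        using ij J S by (simp add: weight_part_def sum.delta)
    qed (use J in auto)
    then show ?thesis using orth by simp
  qed
  then have "\<tau> \<mu> = (\<lambda>_. 0)"
    using shift_minus_kernels_independent[of S "2 * n" \<tau> \<mu>] S killed True by (auto simp: S_def)
  then have "\<tau> \<mu> 0 = 0" by simp
  then show ?thesis by (simp add: \<tau>_def)
qed

text \<open>
  Let \<open>F\<close> be the diagonal matrix with entries \<open>f (J\<^sub>i\<^sub>i)\<close>. Then \<open>tr ([A, B] F) = tr (A [B, F])\<close>, and by
  additivity of \<open>f\<close> commuting with \<open>F\<close> multiplies the part of \<open>B\<close> of weight \<open>\<mu>\<close> by \<open>- f \<mu>\<close>.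
\<close>

lemma replica_orthogonal:
  fixes f :: "'a::field \<Rightarrow> 'a"
  assumes J: "J \<in> carrier_mat n n" and st: "split_triangular J"
    and A: "A \<in> carrier_mat n n" and B: "B \<in> carrier_mat n n"
    and orth: "\<And>k. mtrace (A * (commutator J ^^ k) B) = 0"
    and f: "\<And>x y. f (x - y) = f x - f y"
  shows "mtrace (commutator A B * mat n n (\<lambda>(i, j). if i = j then f (J $$ (i, i)) else 0)) = 0"
proof -
  let ?d = "\<lambda>i. J $$ (i, i)"
  let ?F = "mat n n (\<lambda>(i, j). if i = j then f (J $$ (i, i)) else 0)"
  define S where "S = (\<lambda>(i, j). ?d i - ?d j) ` ({..<n} \<times> {..<n})"
  have S: "finite S" "\<And>i j. i < n \<Longrightarrow> j < n \<Longrightarrow> ?d i - ?d j \<in> S" by (auto simp: S_def)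
  have "mtrace (commutator A B * ?F) = (\<Sum>i<n. commutator A B $$ (i, i) * f (?d i))"
  proof -
    have "(\<Sum>j<n. commutator A B $$ (i, j) * ?F $$ (j, i)) = commutator A B $$ (i, i) * f (?d i)"
      if i: "i < n" for i
    proof -
      have "(\<Sum>j<n. commutator A B $$ (i, j) * ?F $$ (j, i)) =
          (\<Sum>j<n. if j = i then commutator A B $$ (i, i) * f (?d i) else 0)"
        using i by (intro sum.cong) auto
      then show ?thesis using i by simp
    qed
    then show ?thesis using A B by (subst mtrace_mult[of _ n n]) auto
  qed
  also have "\<dots> = (\<Sum>i<n. \<Sum>j<n. A $$ (i, j) * B $$ (j, i) * f (?d i))
      - (\<Sum>i<n. \<Sum>j<n. B $$ (i, j) * A $$ (j, i) * f (?d i))"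
    using A B
    by (simp add: commutator_index[of _ n] left_diff_distrib sum_subtractf sum_distrib_right)
  also have "(\<Sum>i<n. \<Sum>j<n. B $$ (i, j) * A $$ (j, i) * f (?d i)) =
      (\<Sum>i<n. \<Sum>j<n. A $$ (i, j) * B $$ (j, i) * f (?d j))"
    by (subst sum.swap) (simp add: mult_ac)
  finally have "mtrace (commutator A B * ?F) =
      - (\<Sum>i<n. \<Sum>j<n. A $$ (i, j) * B $$ (j, i) * f (?d j - ?d i))"
    by (simp add: f sum_subtractf right_diff_distrib)
  also have "(\<Sum>i<n. \<Sum>j<n. A $$ (i, j) * B $$ (j, i) * f (?d j - ?d i)) =
      (\<Sum>i<n. \<Sum>j<n. \<Sum>\<mu>\<in>S. f \<mu> * (A $$ (i, j) * weight_part J \<mu> B $$ (j, i)))"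
  proof (intro sum.cong refl)
    fix i j assume "i \<in> {..<n}" "j \<in> {..<n}"
    then have ij: "i < n" "j < n" by auto
    have "(\<Sum>\<mu>\<in>S. f \<mu> * (A $$ (i, j) * weight_part J \<mu> B $$ (j, i))) =
        (\<Sum>\<mu>\<in>S. if \<mu> = ?d j - ?d i then f \<mu> * (A $$ (i, j) * B $$ (j, i)) else 0)"
      using ij J by (intro sum.cong) (auto simp: weight_part_def)
    then show "A $$ (i, j) * B $$ (j, i) * f (?d j - ?d i) =
        (\<Sum>\<mu>\<in>S. f \<mu> * (A $$ (i, j) * weight_part J \<mu> B $$ (j, i)))"
      using S ij by (simp add: mult_ac)
  qed
  also have "\<dots> = (\<Sum>i<n. \<Sum>\<mu>\<in>S. \<Sum>j<n. f \<mu> * (A $$ (i, j) * weight_part J \<mu> B $$ (j, i)))"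
    by (intro sum.cong refl sum.swap)
  also have "\<dots> = (\<Sum>\<mu>\<in>S. \<Sum>i<n. \<Sum>j<n. f \<mu> * (A $$ (i, j) * weight_part J \<mu> B $$ (j, i)))"
    by (rule sum.swap)
  also have "\<dots> = (\<Sum>\<mu>\<in>S. f \<mu> * mtrace (A * weight_part J \<mu> B))"
    using A J by (simp add: mtrace_mult[of _ n n] sum_distrib_left)
  also have "\<dots> = 0"
    using weight_part_orthogonal[OF J st A B orth] by simp
  finally show ?thesis by simp
qed

text \<open>The field is a vector space over \<open>\<rat>\<close>, in which \<open>a\<close> extends to a basis.\<close>

lemma rational_functional_exists:
  fixes a :: "'a::field_char_0"
  assumes "a \<noteq> 0"
  obtains f :: "'a \<Rightarrow> rat" where "\<And>x y. f (x + y) = f x + f y" "\<And>q x. f (of_rat q * x) = q * f x" "f a = 1"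
proof -
  interpret vector_space_pair "\<lambda>q (x::'a). of_rat q * x" "(*) :: rat \<Rightarrow> rat \<Rightarrow> rat"
    by unfold_locales (auto simp: algebra_simps of_rat_add of_rat_mult)
  have "vs1.independent {a}" using assms by simp
  then obtain f where f: "Vector_Spaces.linear (\<lambda>q (x::'a). of_rat q * x) (*) f" "f a = 1"
    using linear_independent_extend[of "{a}" "\<lambda>_. 1"] by auto
  interpret f: Vector_Spaces.linear "\<lambda>q (x::'a). of_rat q * x" "(*)" f by (fact f(1))
  show ?thesis using that f.add f.scale f(2) by blast
qed

lemma strictly_triangular_pow:
  fixes J :: "'a::field mat"
  assumes J: "J \<in> carrier_mat n n" and tri: "\<And>i j. i < n \<Longrightarrow> j < n \<Longrightarrow> J $$ (i, j) \<noteq> 0 \<Longrightarrow> i < j"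
  shows "J ^\<^sub>m n = 0\<^sub>m n n"
proof -
  have entry: "i + k \<le> j" if "i < n" "j < n" "(J ^\<^sub>m k) $$ (i, j) \<noteq> 0" for i j k
    using that
  proof (induction k arbitrary: j)
    case 0
    then show ?case using J by (auto split: if_splits)
  next
    case (Suc k)
    have "(J ^\<^sub>m Suc k) $$ (i, j) = (\<Sum>l<n. (J ^\<^sub>m k) $$ (i, l) * J $$ (l, j))"
      using Suc.prems J pow_carrier_mat[OF J, of k] by (auto simp: scalar_prod_def atLeast0LessThan)
    then have "(\<Sum>l<n. (J ^\<^sub>m k) $$ (i, l) * J $$ (l, j)) \<noteq> 0" using Suc.prems(3) by simp
    then obtain l where "l < n" "(J ^\<^sub>m k) $$ (i, l) \<noteq> 0" "J $$ (l, j) \<noteq> 0"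
      by (elim sum.not_neutral_contains_not_neutral) auto
    then show ?case using Suc.IH[of l] Suc.prems tri[of l j] by auto
  qed
  show ?thesis
    using entry[of _ _ n] pow_carrier_mat[OF J, of n] by (intro eq_matI) force+
qed

text \<open>
  The linear algebra in Cartan's criterion. The last hypothesis expresses that \<open>T\<close> is a linear
  combination of the commutators \<open>[A, B]\<close> with \<open>(A, B) \<in> S\<close>, in the form in which it is used: every
  functional \<open>tr (_ Y)\<close> that vanishes on these commutators vanishes at \<open>T\<close>. The matrix \<open>Y\<close> is taken to
  be \<open>f\<close> of the diagonalizable part of \<open>T\<close>, for a \<open>\<rat>\<close>-linear functional \<open>f\<close> that is \<open>1\<close> at a
  supposed nonzero eigenvalue; then \<open>0 = tr (T Y) = \<Sum>\<^sub>i d\<^sub>i f(d\<^sub>i)\<close>, and \<open>f\<close> maps this sum to a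
  positive one.
\<close>

lemma nilpotent_if_orthogonal:
  fixes T :: "'a::{alg_closed_field, field_char_0} mat"
  assumes T: "T \<in> carrier_mat n n"
    and S: "S \<subseteq> carrier_mat n n \<times> carrier_mat n n"
    and orth: "\<And>A B k. (A, B) \<in> S \<Longrightarrow> mtrace (A * (commutator T ^^ k) B) = 0"
    and span: "\<And>Y. Y \<in> carrier_mat n n \<Longrightarrow> (\<And>A B. (A, B) \<in> S \<Longrightarrow> mtrace (commutator A B * Y) = 0)
      \<Longrightarrow> mtrace (T * Y) = 0"
  shows "T ^\<^sub>m n = 0\<^sub>m n n"
proof -
  obtain J P Q where J: "J \<in> carrier_mat n n" and st: "split_triangular J"
    and wit: "similar_mat_wit T J P Q"
    using split_triangular_similar[OF T] unfolding similar_mat_def by blast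
  note wD = similar_mat_witD2[OF T wit]
  have P: "P \<in> carrier_mat n n" and Q: "Q \<in> carrier_mat n n" and PQ: "P * Q = 1\<^sub>m n"
    and QP: "Q * P = 1\<^sub>m n" and TJ: "T = P * J * Q"
    using wD by auto
  \<comment> \<open>The change of basis that turns \<open>T\<close> into \<open>J\<close>; it respects products and traces.\<close>
  define conj where "conj C = Q * C * P" for C
  have conj_c: "conj C \<in> carrier_mat n n" if "C \<in> carrier_mat n n" for C
    using that P Q by (simp add: conj_def)
  have conj_mult: "conj (C * D) = conj C * conj D" if C: "C \<in> carrier_mat n n" and D: "D \<in> carrier_mat n n" for C D
  proof -
    have "conj C * conj D = Q * C * (P * Q) * D * P"
      unfolding conj_def using C D P Q by (simp add: assoc_mult_mat[of _ n n _ n _ n])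
    then show ?thesis using C D P Q PQ by (simp add: conj_def assoc_mult_mat[of _ n n _ n _ n])
  qed
  have conj_diff: "conj (C - D) = conj C - conj D" if "C \<in> carrier_mat n n" "D \<in> carrier_mat n n" for C D
    using that P Q unfolding conj_def
    by (simp add: mult_minus_distrib_mat[of _ n n] minus_mult_distrib_mat[of _ n n])
  have conj_comm: "conj (commutator C D) = commutator (conj C) (conj D)"
    if "C \<in> carrier_mat n n" "D \<in> carrier_mat n n" for C D
    using that by (simp add: commutator_def conj_diff conj_mult)
  have conj_trace: "mtrace (conj C) = mtrace C" if C: "C \<in> carrier_mat n n" for C
    by (rule mtrace_similar[of _ _ Q P], rule similar_mat_witI[OF QP PQ])
       (use C P Q in \<open>auto simp: conj_def\<close>)
  have conj_inv: "conj (P * C * Q) = C" if C: "C \<in> carrier_mat n n" for C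
  proof -
    have "conj (P * C * Q) = (Q * P) * C * (Q * P)"
      unfolding conj_def using C P Q by (simp add: assoc_mult_mat[of _ n n _ n _ n])
    then show ?thesis using C QP by simp
  qed
  have conj_T: "conj T = J" using conj_inv[OF J] TJ by simp
  have conj_pow: "conj ((commutator T ^^ k) C) = (commutator J ^^ k) (conj C)"
    if C: "C \<in> carrier_mat n n" for C k
    by (induction k) (use C T in \<open>auto simp: conj_comm conj_T\<close>)
  have J0: "J $$ (i, i) = 0" if i: "i < n" for i
  proof (rule ccontr)
    assume "J $$ (i, i) \<noteq> 0"
    \<comment> \<open>\<open>f\<close> takes rational values, so that \<open>f (f x * x) = f x * f x\<close>.\<close>
    then obtain f :: "'a \<Rightarrow> rat" where f_add: "\<And>x y. f (x + y) = f x + f y"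
      and f_scale: "\<And>q x. f (of_rat q * x) = q * f x" and f1: "f (J $$ (i, i)) = 1"
      by (rule rational_functional_exists) blast
    have f_diff: "f (x - y) = f x - f y" for x y
      using f_add[of "x - y" y] by simp
    have f_sum: "f (\<Sum>i\<in>I. g i) = (\<Sum>i\<in>I. f (g i))" if "finite I" for I :: "nat set" and g
      using that by (induction I rule: finite_induct) (use f_add f_add[of 0 0] in auto)
    let ?F = "mat n n (\<lambda>(i, j). if i = j then of_rat (f (J $$ (i, i))) else 0) :: 'a mat"
    have F: "?F \<in> carrier_mat n n" by simp
    define Y where "Y = P * ?F * Q"
    have Y: "Y \<in> carrier_mat n n"
      unfolding Y_def by (rule mult_carrier_mat[OF mult_carrier_mat[OF P F] Q])
    have conj_Y: "conj Y = ?F" unfolding Y_def by (rule conj_inv[OF F])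
    have "mtrace (commutator A B * Y) = 0" if AB: "(A, B) \<in> S" for A B
    proof -
      have A: "A \<in> carrier_mat n n" and B: "B \<in> carrier_mat n n" using S AB by auto
      have "mtrace (commutator A B * Y) = mtrace (conj (commutator A B * Y))"
        by (rule conj_trace[symmetric], rule mult_carrier_mat[OF commutator_carrier[OF A B] Y])
      also have "\<dots> = mtrace (commutator (conj A) (conj B) * ?F)"
        using A B Y by (simp add: conj_mult conj_comm conj_Y)
      also have "\<dots> = 0"
      proof (rule replica_orthogonal[OF J st conj_c[OF A] conj_c[OF B]])
        fix k
        have "mtrace (conj A * (commutator J ^^ k) (conj B)) = mtrace (conj (A * (commutator T ^^ k) B))"
          using A B T by (simp add: conj_mult conj_pow)
        also have "\<dots> = mtrace (A * (commutator T ^^ k) B)"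
          by (rule conj_trace) (use A B T in auto)
        finally show "mtrace (conj A * (commutator J ^^ k) (conj B)) = 0" using orth[OF AB] by simp
      qed (simp add: f_diff of_rat_diff)
      finally show ?thesis .
    qed
    then have "mtrace (T * Y) = 0" by (rule span[OF Y])
    moreover have "mtrace (T * Y) = mtrace (conj (T * Y))"
      by (rule conj_trace[symmetric]) (use T Y in auto)
    moreover have "conj (T * Y) = J * ?F" using T Y by (simp add: conj_mult conj_T conj_Y)
    moreover have "mtrace (J * ?F) = (\<Sum>i<n. of_rat (f (J $$ (i, i))) * J $$ (i, i))"
    proof -
      have "(\<Sum>j<n. J $$ (i, j) * ?F $$ (j, i)) = of_rat (f (J $$ (i, i))) * J $$ (i, i)" if i: "i < n" for i
      proof -
        have "(\<Sum>j<n. J $$ (i, j) * ?F $$ (j, i)) =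
            (\<Sum>j<n. if j = i then of_rat (f (J $$ (i, i))) * J $$ (i, i) else 0)"
          using i by (intro sum.cong) auto
        then show ?thesis using i by simp
      qed
      then show ?thesis using J by (subst mtrace_mult[of _ n n]) auto
    qed
    ultimately have "(\<Sum>i<n. of_rat (f (J $$ (i, i))) * J $$ (i, i)) = 0" by simp
    then have "f (\<Sum>i<n. of_rat (f (J $$ (i, i))) * J $$ (i, i)) = 0"
      using f_add[of 0 0] by simp
    then have "(\<Sum>i<n. f (J $$ (i, i)) * f (J $$ (i, i))) = 0"
      by (simp add: f_sum f_scale)
    then have "f (J $$ (i, i)) * f (J $$ (i, i)) = 0"
      using i by (subst (asm) sum_nonneg_eq_0_iff) auto
    then show False using f1 by simp
  qed
  have "J ^\<^sub>m n = 0\<^sub>m n n"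
    using st J J0 by (intro strictly_triangular_pow) (auto simp: split_triangular_def)
  then show ?thesis using similar_mat_wit_pow_id[OF wit, of n] P Q by simp
qed

section \<open>The Killing form and the criterion of Cartan\<close>

context finite_dimensional_lie_algebra
begin

definition basis_list :: "'b list" where
  "basis_list = (SOME bs. set bs = Basis \<and> distinct bs)"

lemma basis_list: "set basis_list = Basis" "distinct basis_list"
  using someI_ex[OF finite_distinct_list[OF finite_Basis]] unfolding basis_list_def by auto

lemma length_basis_list: "length basis_list = dimension"
  using distinct_card[OF basis_list(2)] basis_list(1) by (simp add: dimension_def)

lemma nth_basis_list: "i < dimension \<Longrightarrow> basis_list ! i \<in> Basis"
  using nth_mem[of i basis_list] basis_list(1) length_basis_list by simp

lemma in_span_Basis: "x \<in> span Basis"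
  using span_Basis by simp

lemma basis_expansion:
  "(\<Sum>i<dimension. scale (representation Basis x (basis_list ! i)) (basis_list ! i)) = x"
proof -
  have "(\<Sum>b\<in>Basis. scale (representation Basis x b) b) = x"
    using sum_representation_eq[OF independent_Basis in_span_Basis finite_Basis] by simp
  moreover have "bij_betw ((!) basis_list) {..<dimension} Basis"
    using bij_betw_nth[OF basis_list(2), of "{..<dimension}" Basis] length_basis_list basis_list(1) by auto
  ultimately show ?thesis
    using sum.reindex_bij_betw[of "(!) basis_list" "{..<dimension}" Basis
        "\<lambda>b. scale (representation Basis x b) b"] by simp
qed

definition op_mat :: "('b \<Rightarrow> 'b) \<Rightarrow> 'k mat" where
  "op_mat F = mat dimension dimension (\<lambda>(i, j). representation Basis (F (basis_list ! j)) (basis_list ! i))"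

lemma op_mat_carrier [simp, intro]: "op_mat F \<in> carrier_mat dimension dimension"
  by (simp add: op_mat_def)

lemma op_mat_add: "op_mat (\<lambda>x. F x + G x) = op_mat F + op_mat G"
  by (intro eq_matI) (auto simp: op_mat_def representation_add[OF independent_Basis in_span_Basis in_span_Basis])

lemma op_mat_diff: "op_mat (\<lambda>x. F x - G x) = op_mat F - op_mat G"
  by (intro eq_matI) (auto simp: op_mat_def representation_diff[OF independent_Basis in_span_Basis in_span_Basis])

lemma op_mat_scale: "op_mat (\<lambda>x. scale c (F x)) = c \<cdot>\<^sub>m op_mat F"
  by (intro eq_matI) (auto simp: op_mat_def representation_scale[OF independent_Basis in_span_Basis])

lemma linear_expansion:
  assumes "Vector_Spaces.linear scale scale F"
  shows "F x = (\<Sum>l<dimension. scale (representation Basis x (basis_list ! l)) (F (basis_list ! l)))"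
proof -
  interpret F: Vector_Spaces.linear scale scale F by (fact assms)
  have "F x = F (\<Sum>l<dimension. scale (representation Basis x (basis_list ! l)) (basis_list ! l))"
    by (simp add: basis_expansion)
  then show ?thesis by (simp add: F.sum F.scale)
qed

lemma op_mat_comp:
  assumes F: "Vector_Spaces.linear scale scale F"
  shows "op_mat (\<lambda>x. F (G x)) = op_mat F * op_mat G"
proof (intro eq_matI)
  fix i j assume "i < dim_row (op_mat F * op_mat G)" "j < dim_col (op_mat F * op_mat G)"
  then have ij: "i < dimension" "j < dimension" by (auto simp: op_mat_def)
  let ?r = "representation Basis"
  have "op_mat (\<lambda>x. F (G x)) $$ (i, j) =
      ?r (\<Sum>l<dimension. scale (?r (G (basis_list ! j)) (basis_list ! l)) (F (basis_list ! l))) (basis_list ! i)"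
    using ij by (simp add: op_mat_def linear_expansion[OF F, of "G (basis_list ! j)"])
  also have "\<dots> = (\<Sum>l<dimension. ?r (G (basis_list ! j)) (basis_list ! l) * ?r (F (basis_list ! l)) (basis_list ! i))"
    by (simp add: representation_sum[OF independent_Basis in_span_Basis]
        representation_scale[OF independent_Basis in_span_Basis])
  also have "\<dots> = (op_mat F * op_mat G) $$ (i, j)"
    using ij by (simp add: op_mat_def scalar_prod_def atLeast0LessThan mult.commute)
  finally show "op_mat (\<lambda>x. F (G x)) $$ (i, j) = (op_mat F * op_mat G) $$ (i, j)" .
qed (auto simp: op_mat_def)

lemma linear_funpow:
  assumes F: "Vector_Spaces.linear scale scale F"
  shows "Vector_Spaces.linear scale scale (F ^^ k)"
proof (induction k)
  case 0
  then show ?case using linear_id by (simp add: id_def)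
next
  case (Suc k)
  then show ?case using Vector_Spaces.linear_compose[OF Suc F] by (simp only: funpow.simps)
qed

lemma op_mat_pow:
  assumes F: "Vector_Spaces.linear scale scale F"
  shows "op_mat (F ^^ k) = op_mat F ^\<^sub>m k"
proof (induction k)
  case 0
  have "op_mat (\<lambda>x. x) = 1\<^sub>m dimension"
    using nth_basis_list nth_eq_iff_index_eq[OF basis_list(2)] length_basis_list
    by (intro eq_matI) (auto simp: op_mat_def representation_basis[OF independent_Basis])
  then show ?case by (simp add: id_def op_mat_def)
next
  case (Suc k)
  have "op_mat (F ^^ Suc k) = op_mat (\<lambda>x. (F ^^ k) (F x))"
    by (simp only: funpow_Suc_right comp_def)
  also have "\<dots> = op_mat (F ^^ k) * op_mat F"
    by (rule op_mat_comp[OF linear_funpow[OF F]])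
  finally show ?case by (simp only: Suc pow_mat.simps)
qed

lemma op_mat_zeroD:
  assumes F: "Vector_Spaces.linear scale scale F" and zero: "op_mat F = 0\<^sub>m dimension dimension"
  shows "F x = 0"
proof -
  have "F (basis_list ! l) = 0" if l: "l < dimension" for l
  proof -
    have "representation Basis (F (basis_list ! l)) (basis_list ! i) = 0" if i: "i < dimension" for i
      using arg_cong[OF zero, of "\<lambda>M. M $$ (i, l)"] i l by (simp add: op_mat_def)
    then show ?thesis using basis_expansion[of "F (basis_list ! l)"] by simp
  qed
  then show ?thesis by (subst linear_expansion[OF F]) simp
qed

definition ad :: "'b \<Rightarrow> 'k mat" where
  "ad x = op_mat (bracket x)"

lemma ad_carrier [simp, intro]: "ad x \<in> carrier_mat dimension dimension"
  by (simp add: ad_def)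

lemma ad_add: "ad (x + y) = ad x + ad y"
  using op_mat_add[of "bracket x" "bracket y"] by (simp add: ad_def bracket_add_left[abs_def])

lemma ad_scale: "ad (scale c x) = c \<cdot>\<^sub>m ad x"
  using op_mat_scale[of c "bracket x"] by (simp add: ad_def bracket_scale_left[abs_def])

lemma ad_bracket: "ad (bracket x y) = commutator (ad x) (ad y)"
proof -
  have "ad (bracket x y) = op_mat (\<lambda>z. bracket x (bracket y z) - bracket y (bracket x z))"
    unfolding ad_def by (simp add: bracket_bracket[abs_def])
  then show ?thesis
    by (simp add: op_mat_diff op_mat_comp[OF bracket_linear_right[of x], of "bracket y"]
        op_mat_comp[OF bracket_linear_right[of y], of "bracket x"] ad_def commutator_def)
qed

definition killing :: "'b \<Rightarrow> 'b \<Rightarrow> 'k" where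
  "killing x y = mtrace (ad x * ad y)"

lemma killing_commute: "killing x y = killing y x"
  unfolding killing_def by (rule mtrace_comm) auto

lemma killing_add_left: "killing (x + y) z = killing x z + killing y z"
  unfolding killing_def ad_add
  by (subst add_mult_distrib_mat[of _ dimension dimension])
     (auto intro!: mtrace_add mult_carrier_mat[OF ad_carrier ad_carrier])

lemma killing_scale_left: "killing (scale c x) z = c * killing x z"
  unfolding killing_def ad_scale
  by (subst mult_smult_assoc_mat[of _ dimension dimension])
     (auto intro!: mtrace_smult mult_carrier_mat[OF ad_carrier ad_carrier])

lemma killing_zero_left: "killing 0 z = 0"
  using killing_scale_left[of 0 0 z] by simp

lemma killing_invariant: "killing (bracket x y) z = killing x (bracket y z)"
proof -
  let ?X = "ad x" and ?Y = "ad y" and ?Z = "ad z" and ?n = dimension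
  note c = ad_carrier[of x] ad_carrier[of y] ad_carrier[of z]
  note cc = mult_carrier_mat[OF c(1) c(2)] mult_carrier_mat[OF c(2) c(1)] mult_carrier_mat[OF c(1) c(3)]
    mult_carrier_mat[OF c(2) c(3)] mult_carrier_mat[OF c(3) c(2)]
  have "killing (bracket x y) z = mtrace (?X * ?Y * ?Z) - mtrace (?Y * ?X * ?Z)"
    unfolding killing_def ad_bracket commutator_def
    unfolding minus_mult_distrib_mat[OF cc(1,2) c(3)]
    by (rule mtrace_diff[OF mult_carrier_mat[OF cc(1) c(3)] mult_carrier_mat[OF cc(2) c(3)]])
  also have "?Y * ?X * ?Z = ?Y * (?X * ?Z)" by (rule assoc_mult_mat[OF c(2,1,3)])
  also have "mtrace (?Y * (?X * ?Z)) = mtrace (?X * ?Z * ?Y)" by (rule mtrace_comm[OF c(2) cc(3)])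
  also have "?X * ?Z * ?Y = ?X * (?Z * ?Y)" by (rule assoc_mult_mat[OF c(1,3,2)])
  also have "?X * ?Y * ?Z = ?X * (?Y * ?Z)" by (rule assoc_mult_mat[OF c])
  also have "mtrace (?X * (?Y * ?Z)) - mtrace (?X * (?Z * ?Y)) = mtrace (?X * (?Y * ?Z) - ?X * (?Z * ?Y))"
    by (rule mtrace_diff[symmetric, OF mult_carrier_mat[OF c(1) cc(4)] mult_carrier_mat[OF c(1) cc(5)]])
  also have "?X * (?Y * ?Z) - ?X * (?Z * ?Y) = ?X * (?Y * ?Z - ?Z * ?Y)"
    by (rule mult_minus_distrib_mat[symmetric, OF c(1) cc(4,5)])
  finally show ?thesis by (simp add: killing_def ad_bracket commutator_def)
qed

end

locale finite_dimensional_lie_algebra_char_0 = finite_dimensional_lie_algebra scale bracket Basis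
  for scale :: "'k::field_char_0 \<Rightarrow> 'b::ab_group_add \<Rightarrow> 'b"
    and bracket :: "'b \<Rightarrow> 'b \<Rightarrow> 'b"
    and Basis :: "'b set"
begin

text \<open>
  Only the matrix of \<open>ad x\<close> is regarded over the algebraic closure. The matrices \<open>A\<close> and \<open>B\<close> paired
  with it come from \<open>N\<close> itself, and \<open>N\<close> is closed under \<open>ad x\<close>, so all traces to be considered are
  values of the Killing form on \<open>N\<close>.
\<close>

lemma ad_nilpotent_if_killing_zero:
  assumes N: "lie_subalgebra N" and zero: "\<And>x y. x \<in> N \<Longrightarrow> y \<in> N \<Longrightarrow> killing x y = 0"
    and x: "x \<in> bracket_space N N"
  shows "\<exists>k. \<forall>y. (bracket x ^^ k) y = 0"
proof -
  let ?n = dimension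
  interpret h: inj_comm_ring_hom "to_ac :: 'k \<Rightarrow> 'k alg_closure"
    by unfold_locales auto
  define A where "A z = map_mat to_ac (ad z)" for z
  have A: "A z \<in> carrier_mat ?n ?n" for z using ad_carrier[of z] by (simp add: A_def)
  have sN: "subspace N" and clN: "\<And>x y. x \<in> N \<Longrightarrow> y \<in> N \<Longrightarrow> bracket x y \<in> N"
    using N by (auto simp: lie_subalgebra_def)
  have xN: "x \<in> N" using x bracket_space_subset[OF sN clN] by blast
  have A_mult: "map_mat to_ac (ad y * ad z) = A y * A z" for y z
    unfolding A_def by (rule h.mat_hom_mult[OF ad_carrier ad_carrier])
  have A_trace: "mtrace (A y * A z) = to_ac (killing y z)" for y z
  proof -
    have "mtrace (map_mat to_ac M) = to_ac (mtrace M)" if "M \<in> carrier_mat ?n ?n" for M :: "'k mat"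
      using that by (auto simp: mtrace_def to_ac_sum)
    then show ?thesis
      unfolding A_mult[symmetric] killing_def by (simp add: mult_carrier_mat[OF ad_carrier ad_carrier])
  qed
  have A_bracket: "A (bracket y z) = commutator (A y) (A z)" for y z
  proof -
    have "map_mat to_ac (M - M') = map_mat to_ac M - map_mat to_ac M'"
      if "M \<in> carrier_mat ?n ?n" "M' \<in> carrier_mat ?n ?n" for M M' :: "'k mat"
      using that by (intro eq_matI) auto
    then show ?thesis
      unfolding commutator_def A_mult[symmetric]
      by (simp add: A_def ad_bracket commutator_def mult_carrier_mat[OF ad_carrier ad_carrier])
  qed
  have A_pow: "A ((bracket x ^^ k) z) = (commutator (A x) ^^ k) (A z)" for k z
    by (induction k) (simp_all add: A_bracket)
  have "A x ^\<^sub>m ?n = 0\<^sub>m ?n ?n"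
  proof (rule nilpotent_if_orthogonal[where S = "{(A a, A b) | a b. a \<in> N \<and> b \<in> N}"])
    fix C D :: "'k alg_closure mat" and k
    assume "(C, D) \<in> {(A a, A b) | a b. a \<in> N \<and> b \<in> N}"
    then obtain a b where ab: "a \<in> N" "b \<in> N" and CD: "C = A a" "D = A b" by auto
    have "(bracket x ^^ k) b \<in> N" by (induction k) (use ab xN clN in auto)
    then show "mtrace (C * (commutator (A x) ^^ k) D) = 0"
      using zero[OF ab(1)] by (simp add: CD A_pow[symmetric] A_trace)
  next
    fix Y :: "'k alg_closure mat"
    assume Y: "Y \<in> carrier_mat ?n ?n"
      and orth: "\<And>C D. (C, D) \<in> {(A a, A b) | a b. a \<in> N \<and> b \<in> N} \<Longrightarrow> mtrace (commutator C D * Y) = 0"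
    have A_add: "A (y + z) = A y + A z" for y z
      using ad_carrier[of y] ad_carrier[of z] by (intro eq_matI) (auto simp: A_def ad_add carrier_matD[OF ad_carrier])
    have A_scale: "A (scale c y) = to_ac c \<cdot>\<^sub>m A y" for c y
      using ad_carrier[of y] by (intro eq_matI) (auto simp: A_def ad_scale)
    have "subspace {z. mtrace (A z * Y) = 0}"
    proof (rule subspaceI)
      have "mtrace (A (scale 0 0) * Y) = 0"
        unfolding A_scale using A[of 0] Y
        by (simp add: mult_smult_assoc_mat[of _ ?n ?n _ ?n] mtrace_smult[of _ ?n])
      then show "0 \<in> {z. mtrace (A z * Y) = 0}" by simp
    next
      fix y z assume "y \<in> {z. mtrace (A z * Y) = 0}" "z \<in> {z. mtrace (A z * Y) = 0}"
      then show "y + z \<in> {z. mtrace (A z * Y) = 0}"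
        by (simp add: A_add add_mult_distrib_mat[OF A A Y]
            mtrace_add[OF mult_carrier_mat[OF A Y] mult_carrier_mat[OF A Y]])
    next
      fix c z assume "z \<in> {z. mtrace (A z * Y) = 0}"
      then show "scale c z \<in> {z. mtrace (A z * Y) = 0}"
        using A[of z] Y by (simp add: A_scale mult_smult_assoc_mat[of _ ?n ?n _ ?n] mtrace_smult[of _ ?n])
    qed
    then have "bracket_space N N \<subseteq> {z. mtrace (A z * Y) = 0}"
      by (rule bracket_space_subset) (use orth in \<open>auto simp: A_bracket\<close>)
    then show "mtrace (A x * Y) = 0" using x by auto
  qed (use A in auto)
  moreover have "map_mat to_ac (0\<^sub>m ?n ?n :: 'k mat) = 0\<^sub>m ?n ?n"
    by (intro eq_matI) auto
  ultimately have "map_mat to_ac (ad x ^\<^sub>m ?n) = map_mat to_ac (0\<^sub>m ?n ?n)"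
    by (simp add: A_def h.mat_hom_pow[OF ad_carrier])
  then have "ad x ^\<^sub>m ?n = 0\<^sub>m ?n ?n"
    by (rule h.mat_hom_inj)
  then have zero: "op_mat (bracket x ^^ ?n) = 0\<^sub>m ?n ?n"
    by (simp add: op_mat_pow[OF bracket_linear_right] ad_def)
  then show ?thesis using op_mat_zeroD[OF linear_funpow[OF bracket_linear_right] zero] by blast
qed

text \<open>
  Cartan's criterion. If \<open>[N, N]\<close> is smaller than \<open>N\<close>, induction on the dimension applies to it;
  otherwise \<open>N\<close> is perfect and consists of ad-nilpotent elements, so it is zero.
\<close>

lemma solvable_if_killing_zero:
  assumes "lie_subalgebra N" and "\<And>x y. x \<in> N \<Longrightarrow> y \<in> N \<Longrightarrow> killing x y = 0"
  shows "solvable N"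
  using assms
proof (induction "dim N" arbitrary: N rule: less_induct)
  case less
  let ?D = "bracket_space N N"
  have sN: "subspace N" and clN: "\<And>x y. x \<in> N \<Longrightarrow> y \<in> N \<Longrightarrow> bracket x y \<in> N"
    using less.prems(1) by (auto simp: lie_subalgebra_def)
  have DN: "?D \<subseteq> N" by (rule bracket_space_subset[OF sN clN])
  have sD: "lie_subalgebra ?D"
    unfolding lie_subalgebra_def using DN bracket_in_bracket_space[of _ N _ N]
    by (auto simp: bracket_space_def)
  show ?case
  proof (cases "?D = N")
    case True
    have "N = {0}"
      by (rule perfect_nilpotent_trivial[OF less.prems(1) _ True], rule ad_nilpotent_if_killing_zero[OF less.prems])
         (use True in auto)
    then have "derived_series N 0 = {0}" by simp
    then show ?thesis unfolding solvable_def by blast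
  next
    case False
    then have "dim ?D < dim N"
      using dim_less[of ?D N] sD sN DN by (auto simp: lie_subalgebra_def)
    then have "solvable ?D"
      by (rule less.hyps[OF _ sD]) (use less.prems(2) DN in auto)
    then obtain m where m: "derived_series ?D m = {0}" by (auto simp: solvable_def)
    have "derived_series N (Suc k) = derived_series ?D k" for k
      by (induction k) simp_all
    then show ?thesis using m unfolding solvable_def by metis
  qed
qed

lemma lie_ideal_killing_orthogonal:
  assumes I: "lie_ideal I UNIV"
  shows "lie_ideal {x \<in> I. \<forall>y\<in>I. killing x y = 0} UNIV"
proof -
  have sI: "subspace I" and cl: "\<And>x y. y \<in> I \<Longrightarrow> bracket x y \<in> I"
    using I by (auto simp: lie_ideal_def)
  have inv: "killing (bracket x y) z = - killing y (bracket x z)" for x y z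
    using killing_invariant[of y x z] killing_scale_left[of "-1" "bracket y x" z]
    by (simp add: bracket_anticomm[of x y])
  show ?thesis
    unfolding lie_ideal_def subspace_def
    using cl sI
    by (auto simp: inv killing_add_left killing_scale_left killing_zero_left subspace_0 subspace_add
        subspace_scale)
qed

text \<open>
  The Killing form is nondegenerate on \<open>I\<close>, because its radical \<open>N\<close> there is a solvable ideal. The map
  \<open>\<phi> x = \<Sum>\<^sub>e \<kappa>(x, e) e\<close>, summed over a basis of \<open>I\<close>, has kernel \<open>I\<^sup>\<bottom>\<close> and image in \<open>I\<close>. Being injective
  on \<open>I\<close> it maps \<open>I\<close> onto \<open>I\<close>, which splits \<open>x\<close> into a component in \<open>I\<close> and one in \<open>I\<^sup>\<bottom>\<close>.
  The latter centralizes \<open>I\<close>, as its brackets with \<open>I\<close> lie in \<open>N\<close>.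
\<close>

lemma semisimple_ideal_complement:
  assumes ss: semisimple and I: "lie_ideal I UNIV"
  shows "I \<inter> centralizer I = {0}" and "\<exists>y\<in>I. x - y \<in> centralizer I"
proof -
  have sI: "subspace I" and cl: "\<And>x y. y \<in> I \<Longrightarrow> bracket x y \<in> I"
    using I by (auto simp: lie_ideal_def)
  define N where "N = {x \<in> I. \<forall>y\<in>I. killing x y = 0}"
  have N: "lie_ideal N UNIV" unfolding N_def by (rule lie_ideal_killing_orthogonal[OF I])
  have "lie_subalgebra N" using N by (auto simp: lie_ideal_def lie_subalgebra_def)
  then have "solvable N" by (rule solvable_if_killing_zero) (auto simp: N_def)
  then have N0: "N = {0}" using ss N by (auto simp: semisimple_def)
  obtain E where E: "E \<subseteq> I" "independent E" "I \<subseteq> span E" using maximal_independent_subset by blast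
  have fE: "finite E" using finiteI_independent[OF E(2)] .
  have spanE: "span E = I" using E sI by (metis span_minimal subset_antisym)
  define \<phi> where "\<phi> x = (\<Sum>e\<in>E. scale (killing x e) e)" for x
  have \<phi>_lin: "Vector_Spaces.linear scale scale \<phi>"
    unfolding Vector_Spaces.linear_iff \<phi>_def
    using vector_space_axioms
    by (auto simp: killing_add_left killing_scale_left scale_left_distrib sum.distrib scale_sum_right)
  interpret \<phi>: Vector_Spaces.linear scale scale \<phi> by (fact \<phi>_lin)
  have \<phi>I: "\<phi> x \<in> I" for x
    unfolding \<phi>_def using E(1) by (intro subspace_sum[OF sI] subspace_scale[OF sI]) auto
  have \<phi>0: "killing x y = 0" if x: "\<phi> x = 0" and y: "y \<in> I" for x y
  proof -
    have "killing e x = 0" if e: "e \<in> E" for e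
      using independentD[OF E(2) fE subset_refl, of "killing x" e] x e
      by (simp add: \<phi>_def killing_commute)
    then have "E \<subseteq> {y. killing y x = 0}" by auto
    moreover have "subspace {y. killing y x = 0}"
      by (auto simp: subspace_def killing_add_left killing_scale_left killing_zero_left)
    ultimately have "I \<subseteq> {y. killing y x = 0}" unfolding spanE[symmetric] by (rule span_minimal)
    then show ?thesis using y by (auto simp: killing_commute)
  qed
  have inj: "inj_on \<phi> I"
    unfolding inj_on_def
  proof (intro ballI impI)
    fix x y assume xy: "x \<in> I" "y \<in> I" "\<phi> x = \<phi> y"
    then have "x - y \<in> N"
      using \<phi>0[of "x - y"] subspace_diff[OF sI] by (auto simp: N_def \<phi>.diff)
    then show "x = y" using N0 by simp
  qed
  interpret p: finite_dimensional_vector_space_pair scale Basis scale Basis by unfold_locales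
  have "dim (\<phi> ` I) = dim I"
    using p.dim_image_eq[OF \<phi>_lin, of I] inj sI by (simp add: span_eq_iff[THEN iffD2])
  then have "\<phi> ` I = I"
    using \<phi>I by (intro subspace_dim_equal \<phi>.subspace_image sI) auto
  then obtain y where y: "y \<in> I" "\<phi> x = \<phi> y" using \<phi>I[of x] by (metis imageE)
  have orth: "killing (x - y) z = 0" if "z \<in> I" for z
    using \<phi>0[of "x - y" z] that y by (simp add: \<phi>.diff)
  have "bracket (x - y) z = 0" if z: "z \<in> I" for z
  proof -
    have "bracket (x - y) z \<in> N"
      using cl z orth by (auto simp: N_def killing_invariant)
    then show ?thesis using N0 by simp
  qed
  then show "\<exists>y\<in>I. x - y \<in> centralizer I" using y(1) by (auto simp: centralizer_def)
  let ?Z = "I \<inter> centralizer I"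
  have Z: "lie_ideal ?Z UNIV"
    by (rule lie_ideal_Int[OF I centralizer_lie_ideal[OF I]])
  have "bracket_space ?Z ?Z \<subseteq> {0}"
    by (rule bracket_space_subset) (auto simp: centralizer_def)
  then have "derived_series ?Z 1 = {0}"
    using span_zero by (auto simp: bracket_space_def)
  then have "solvable ?Z" unfolding solvable_def by blast
  then show "?Z = {0}" using ss Z by (auto simp: semisimple_def)
qed

end

section \<open>Module Lie algebras over Hopf algebras\<close>

lemma lin_ext_superset:
  assumes "vector_space scale" "finite A" "Poly_Mapping.keys t \<subseteq> A"
  shows "lin_ext scale f t = (\<Sum>x\<in>A. scale (Poly_Mapping.lookup t x) (f x))"
proof -
  interpret vector_space scale by fact
  show ?thesis
    unfolding lin_ext_def using assms(2,3)
    by (intro sum.mono_neutral_left) (auto simp: in_keys_iff)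
qed

lemma lin_ext_linear:
  assumes "vector_space scale"
  shows "Vector_Spaces.linear free_scale scale (lin_ext scale f)"
proof -
  interpret vector_space scale by fact
  have "lin_ext scale f (t + u) = lin_ext scale f t + lin_ext scale f u" for t u
    using keys_add[of t u]
    by (simp add: lin_ext_superset[OF assms, of "Poly_Mapping.keys t \<union> Poly_Mapping.keys u"]
        lookup_add scale_left_distrib sum.distrib)
  moreover have "lin_ext scale f (free_scale c t) = scale c (lin_ext scale f t)" for c t
  proof -
    have "Poly_Mapping.keys (free_scale c t) \<subseteq> Poly_Mapping.keys t"
      by (auto simp: in_keys_iff)
    then show ?thesis
      by (simp add: lin_ext_superset[OF assms, of "Poly_Mapping.keys t"] scale_sum_right)
  qed
  ultimately show ?thesis
    unfolding Vector_Spaces.linear_iff using assms free.vector_space_axioms by auto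
qed

lemma lin_ext_gen:
  assumes "vector_space scale"
  shows "lin_ext scale f (gen x) = f x"
proof -
  interpret vector_space scale by fact
  show ?thesis by (simp add: lin_ext_def)
qed

lemma linear_lin_ext:
  assumes "Vector_Spaces.linear scale scale' L"
  shows "L (lin_ext scale f t) = lin_ext scale' (\<lambda>x. L (f x)) t"
proof -
  interpret Vector_Spaces.linear scale scale' L by fact
  show ?thesis by (simp add: lin_ext_def sum scale)
qed

lemma lin_ext_relations3:
  assumes "vector_space scaleB"
    and "\<And>y z. Vector_Spaces.linear scale scaleB (\<lambda>x. f (x, y, z))"
    and "\<And>x z. Vector_Spaces.linear scale scaleB (\<lambda>y. f (x, y, z))"
    and "\<And>x y. Vector_Spaces.linear scale scaleB (\<lambda>z. f (x, y, z))"
    and "t \<in> relations3 scale"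
  shows "lin_ext scaleB f t = 0"
proof -
  interpret L: Vector_Spaces.linear free_scale scaleB "lin_ext scaleB f"
    by (rule lin_ext_linear[OF assms(1)])
  note m = module_hom.add[OF assms(2)[folded module_hom_iff_linear]]
    module_hom.add[OF assms(3)[folded module_hom_iff_linear]]
    module_hom.add[OF assms(4)[folded module_hom_iff_linear]]
    module_hom.scale[OF assms(2)[folded module_hom_iff_linear]]
    module_hom.scale[OF assms(3)[folded module_hom_iff_linear]]
    module_hom.scale[OF assms(4)[folded module_hom_iff_linear]]
  have "relations3 scale \<subseteq> {t. lin_ext scaleB f t = 0}"
    unfolding relations3_def
    by (rule free.span_minimal)
       (auto simp: L.diff L.scale L.add lin_ext_gen[OF assms(1)] m free.subspace_def L.zero)
  then show ?thesis using assms(5) by auto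
qed

text \<open>
  The universal property of \<open>V \<otimes> V \<otimes> V\<close>: a trilinear map may be evaluated on any representative.
  Coassociativity, an equation between cosets, enters computations in this way.
\<close>

lemma lin_ext_tensor_class3:
  assumes "vector_space scaleB"
    and "\<And>y z. Vector_Spaces.linear scale scaleB (\<lambda>x. f (x, y, z))"
    and "\<And>x z. Vector_Spaces.linear scale scaleB (\<lambda>y. f (x, y, z))"
    and "\<And>x y. Vector_Spaces.linear scale scaleB (\<lambda>z. f (x, y, z))"
    and "tensor_class3 scale t = tensor_class3 scale u"
  shows "lin_ext scaleB f t = lin_ext scaleB f u"
proof -
  interpret L: Vector_Spaces.linear free_scale scaleB "lin_ext scaleB f"
    by (rule lin_ext_linear[OF assms(1)])
  have "t \<in> tensor_class3 scale t"
    by (simp add: tensor_class3_def relations3_def free.span_zero)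
  then have "t - u \<in> relations3 scale" unfolding assms(5) by (simp add: tensor_class3_def)
  then have "lin_ext scaleB f (t - u) = 0" by (rule lin_ext_relations3[OF assms(1-4)])
  then show ?thesis by (simp add: L.diff)
qed

lemma (in hopf_algebra) comult_representative: "\<exists>d. \<forall>x. d x \<in> \<Delta> x"
proof -
  have "\<exists>t. t \<in> \<Delta> x" for x
  proof -
    obtain t where "\<Delta> x = tensor_class2 scale t"
      using comult_tensor[of x] by (auto simp: tensor_square_def)
    moreover have "t \<in> tensor_class2 scale t"
      by (simp add: tensor_class2_def relations2_def free.span_zero)
    ultimately show ?thesis by blast
  qed
  then show ?thesis by metis
qed

context H_module_lie_algebra
begin

text \<open>
  Evaluate the trilinear map \<open>(x, y, z) \<mapsto> [x b, y S(z) a]\<close> at the two sides of coassociativity. On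
  \<open>(\<Delta> \<otimes> id) (\<Delta> h)\<close> it gives \<open>h\<^sub>1 [b, S(h\<^sub>2) a] = 0\<close>, and on \<open>(id \<otimes> \<Delta>) (\<Delta> h)\<close> it gives
  \<open>[h\<^sub>1 b, \<epsilon>(h\<^sub>2) a] = [h b, a]\<close> by the antipode and counit axioms.
\<close>

lemma centralizer_H_submodule:
  assumes I: "H_submodule I"
  shows "H_submodule (centralizer I)"
proof -
  have "bracket (act h b) a = 0" if b: "b \<in> centralizer I" and a: "a \<in> I" for h b a
  proof -
    obtain d where d: "\<And>x. d x \<in> \<Delta> x" using H.comult_representative by blast
    define \<Phi> where "\<Phi> = (\<lambda>(x, y, z). bracket (act x b) (act y (act (S z) a)))"
    have comp: "Vector_Spaces.linear scaleH scaleB (\<lambda>x. L (M x))"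
      if "Vector_Spaces.linear scaleB scaleB L" "Vector_Spaces.linear scaleH scaleB M" for L M
      using Vector_Spaces.linear_compose[OF that(2,1)] by (simp add: comp_def)
    have lin1: "Vector_Spaces.linear scaleH scaleB (\<lambda>x. bracket (act x u) v)" for u v
      by (rule comp[OF bracket_linear_left act_linear_left])
    have lin2: "Vector_Spaces.linear scaleH scaleB (\<lambda>x. bracket u (act x v))" for u v
      by (rule comp[OF bracket_linear_right act_linear_left])
    have lin3: "Vector_Spaces.linear scaleH scaleB (\<lambda>z. bracket u (act y (act (S z) a)))" for u y
    proof -
      have "Vector_Spaces.linear scaleH scaleB (\<lambda>z. act (S z) a)"
        using Vector_Spaces.linear_compose[OF H.antipode_linear act_linear_left[of a]]
        by (simp add: comp_def)
      then have "Vector_Spaces.linear scaleH scaleB (\<lambda>z. act y (act (S z) a))"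
        by (rule comp[OF act_linear_right])
      then show ?thesis by (rule comp[OF bracket_linear_right])
    qed
    interpret L: Vector_Spaces.linear free_scale scaleB "lin_ext scaleB \<Phi>"
      by (rule lin_ext_linear[OF vector_space_axioms])
    note push = linear_lin_ext[OF L.linear_axioms]
    let ?t = "lin_ext free_scale
      (\<lambda>(x, y). lin_ext free_scale (\<lambda>(x1, x2). gen (x1, x2, y)) (d x)) (d h)"
    let ?u = "lin_ext free_scale
      (\<lambda>(x, y). lin_ext free_scale (\<lambda>(y1, y2). gen (x, y1, y2)) (d y)) (d h)"
    have "lin_ext scaleB \<Phi> ?t = lin_ext scaleB \<Phi> ?u"
      by (rule lin_ext_tensor_class3[OF vector_space_axioms, where scale = scaleH])
         (simp_all add: \<Phi>_def lin1 lin2 lin3 H.coassoc[OF d])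
    moreover have "lin_ext scaleB \<Phi> ?t = 0"
    proof -
      have "lin_ext scaleB (\<lambda>(x1, x2). \<Phi> (x1, x2, y)) (d x) = 0" for x y
      proof -
        have "bracket b (act (S y) a) = 0"
          using a b I by (auto simp: centralizer_def H_submodule_def)
        then have "act x (bracket b (act (S y) a)) = 0"
          using module_hom.zero[OF act_linear_right[folded module_hom_iff_linear]] by simp
        then show ?thesis unfolding act_bracket[OF d] \<Phi>_def by simp
      qed
      then show ?thesis
        by (simp add: push lin_ext_gen[OF vector_space_axioms] case_prod_unfold)
           (simp add: lin_ext_def)
    qed
    moreover have "lin_ext scaleB \<Phi> ?u = bracket (act h b) a"
    proof -
      have "lin_ext scaleB (\<lambda>(y1, y2). \<Phi> (x, y1, y2)) (d y) = bracket (act (scaleH (\<epsilon> y) x) b) a" for x y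
      proof -
        have "lin_ext scaleB (\<lambda>(y1, y2). \<Phi> (x, y1, y2)) (d y) =
            bracket (act x b) (act (lin_ext scaleH (\<lambda>(y1, y2). y1 * S y2) (d y)) a)"
          unfolding linear_lin_ext[OF lin2] by (simp add: \<Phi>_def case_prod_unfold act_mult)
        also have "\<dots> = scaleB (\<epsilon> y) (bracket (act x b) (act 1 a))"
          unfolding H.antipode_right[OF d] using module_hom.scale[OF lin2[folded module_hom_iff_linear]] by simp
        also have "\<dots> = bracket (act (scaleH (\<epsilon> y) x) b) a"
          using module_hom.scale[OF lin1[folded module_hom_iff_linear], of "\<epsilon> y" x b a] by (simp add: act_one)
        finally show ?thesis .
      qed
      then have "lin_ext scaleB \<Phi> ?u = lin_ext scaleB (\<lambda>(x, y). bracket (act (scaleH (\<epsilon> y) x) b) a) (d h)"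
        by (simp add: push lin_ext_gen[OF vector_space_axioms] case_prod_unfold)
      also have "\<dots> = bracket (act (lin_ext scaleH (\<lambda>(x, y). scaleH (\<epsilon> y) x) (d h)) b) a"
        unfolding linear_lin_ext[OF lin1] by (simp add: case_prod_unfold)
      finally show ?thesis by (simp add: H.counit_right[OF d])
    qed
    ultimately show ?thesis by simp
  qed
  then show ?thesis
    unfolding H_submodule_def subspace_def
    by (auto simp: centralizer_def bracket_add_left bracket_scale_left)
qed

end

locale semisimple_H_module_lie_algebra =
  H_module_lie_algebra scaleH \<Delta> \<epsilon> S scaleB bracket act +
  finite_dimensional_lie_algebra_char_0 scaleB bracket Basis
  for scaleH :: "'k::field_char_0 \<Rightarrow> 'h::ring_1 \<Rightarrow> 'h"
    and \<Delta> :: "'h \<Rightarrow> ('h \<times> 'h \<Rightarrow>\<^sub>0 'k) set"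
    and \<epsilon> :: "'h \<Rightarrow> 'k"
    and S :: "'h \<Rightarrow> 'h"
    and scaleB :: "'k \<Rightarrow> 'b::ab_group_add \<Rightarrow> 'b"
    and bracket :: "'b \<Rightarrow> 'b \<Rightarrow> 'b"
    and act :: "'h \<Rightarrow> 'b \<Rightarrow> 'b"
    and Basis :: "'b set" +
  assumes ss: semisimple
begin

text \<open>
  An ideal of \<open>I\<close> is stable under \<open>B = I + C(I)\<close>, as \<open>C(I)\<close> acts on it as zero.
\<close>

lemma minimal_H_ideal_simple:
  assumes I: "lie_ideal I UNIV" "H_submodule I"
    and min: "\<And>K. lie_ideal K UNIV \<Longrightarrow> H_submodule K \<Longrightarrow> K \<subseteq> I \<Longrightarrow> K \<noteq> {0} \<Longrightarrow> K = I"
  shows "H_simple I"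
proof -
  have "lie_ideal K UNIV" if K: "lie_ideal K I" for K
  proof -
    have "bracket x k \<in> K" if k: "k \<in> K" for x k
    proof -
      obtain y where y: "y \<in> I" "x - y \<in> centralizer I"
        using semisimple_ideal_complement(2)[OF ss I(1)] by blast
      have "bracket (x - y) k = 0" using y(2) k K by (auto simp: centralizer_def lie_ideal_def)
      then have "bracket x k = bracket y k" by (simp add: bracket_diff_left)
      then show ?thesis using y(1) k K by (auto simp: lie_ideal_def)
    qed
    then show ?thesis using K by (auto simp: lie_ideal_def)
  qed
  then have "K = {0} \<or> K = I" if "lie_ideal K I" "H_submodule K" for K
    using min[of K] that by (auto simp: lie_ideal_def)
  then show ?thesis
    using I by (auto simp: H_simple_def lie_subalgebra_def lie_ideal_def)
qed

text \<open>
  Split off an \<open>H\<close>-stable ideal \<open>I\<close> of minimal positive dimension and continue with \<open>M \<inter> C(I)\<close>.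
\<close>

lemma H_ideal_decomposition:
  assumes "lie_ideal M UNIV" "H_submodule M"
  shows "\<exists>s B. (\<forall>i\<in>{1..s}. lie_ideal (B i) UNIV \<and> H_submodule (B i) \<and> H_simple (B i) \<and> B i \<subseteq> M) \<and>
    (\<forall>x\<in>M. \<exists>!f. f \<in> (\<Pi>\<^sub>E i\<in>{1..s::nat}. B i) \<and> x = (\<Sum>i\<in>{1..s}. f i))"
  using assms
proof (induction "dim M" arbitrary: M rule: less_induct)
  case less
  have sM: "subspace M" using less.prems(2) by (simp add: H_submodule_def)
  show ?case
  proof (cases "M = {0}")
    case True
    show ?thesis by (rule exI[of _ 0]) (simp add: True)
  next
    case False
    define P where "P V \<longleftrightarrow> lie_ideal V UNIV \<and> H_submodule V \<and> V \<subseteq> M \<and> V \<noteq> {0}" for V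
    obtain I where I: "P I" and min: "\<And>V. P V \<Longrightarrow> dim I \<le> dim V"
      using ex_has_least_nat[of P M dim] less.prems False by (auto simp: P_def)
    have Ii: "lie_ideal I UNIV" and IH: "H_submodule I" and IM: "I \<subseteq> M" and I0: "I \<noteq> {0}"
      using I by (auto simp: P_def)
    have sI: "subspace I" using IH by (simp add: H_submodule_def)
    have simple: "H_simple I"
    proof (rule minimal_H_ideal_simple[OF Ii IH])
      fix K assume K: "lie_ideal K UNIV" "H_submodule K" "K \<subseteq> I" "K \<noteq> {0}"
      then have "dim I \<le> dim K" using IM by (intro min) (auto simp: P_def)
      then show "K = I" using K sI by (intro subspace_dim_equal) (auto simp: H_submodule_def)
    qed
    define M' where "M' = M \<inter> centralizer I"
    have M'i: "lie_ideal M' UNIV"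
      unfolding M'_def by (rule lie_ideal_Int[OF less.prems(1) centralizer_lie_ideal[OF Ii]])
    have M'H: "H_submodule M'"
      using less.prems(2) centralizer_H_submodule[OF IH]
      by (auto simp: M'_def H_submodule_def subspace_inter)
    have sM': "subspace M'" using M'H by (simp add: H_submodule_def)
    have disj: "I \<inter> M' = {0}"
      using semisimple_ideal_complement(1)[OF ss Ii] sI sM' subspace_0 by (auto simp: M'_def)
    have "M' \<noteq> M" using disj IM I0 by auto
    then have "dim M' < dim M" by (intro dim_less sM sM') (auto simp: M'_def)
    from less.hyps[OF this M'i M'H] obtain s B
      where sB: "(\<forall>i\<in>{1..s::nat}.
          lie_ideal (B i) UNIV \<and> H_submodule (B i) \<and> H_simple (B i) \<and> B i \<subseteq> M') \<and>
        (\<forall>x\<in>M'. \<exists>!f. f \<in> (\<Pi>\<^sub>E i\<in>{1..s}. B i) \<and> x = (\<Sum>i\<in>{1..s}. f i))"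
      by (elim exE)
    note B = bspec[OF conjunct1[OF sB]] and dec = bspec[OF conjunct2[OF sB]]
    define B' where "B' = B(Suc s := I)"
    have B'_simps: "B' (Suc s) = I" "\<And>i. i \<in> {1..s} \<Longrightarrow> B' i = B i" by (auto simp: B'_def)
    have set: "{1..Suc s} = insert (Suc s) {1..s}" by auto
    have "\<exists>!f. f \<in> (\<Pi>\<^sub>E i\<in>{1..Suc s}. B' i) \<and> x = (\<Sum>i\<in>{1..Suc s}. f i)" if x: "x \<in> M" for x
    proof -
      obtain y where y: "y \<in> I" "x - y \<in> centralizer I"
        using semisimple_ideal_complement(2)[OF ss Ii] by blast
      have xy: "x - y \<in> M'" using y x IM sM by (auto simp: M'_def intro: subspace_diff)
      obtain f where f: "f \<in> (\<Pi>\<^sub>E i\<in>{1..s}. B i)" "x - y = (\<Sum>i\<in>{1..s}. f i)"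
        and uniq: "\<And>g. g \<in> (\<Pi>\<^sub>E i\<in>{1..s}. B i) \<Longrightarrow> x - y = (\<Sum>i\<in>{1..s}. g i) \<Longrightarrow> g = f"
        using dec[OF xy] by (elim ex1E) auto
      show ?thesis
      proof (rule ex1I[of _ "f(Suc s := y)"])
        show "f(Suc s := y) \<in> (\<Pi>\<^sub>E i\<in>{1..Suc s}. B' i) \<and> x = (\<Sum>i\<in>{1..Suc s}. (f(Suc s := y)) i)"
        proof
          have "f \<in> (\<Pi>\<^sub>E i\<in>{1..s}. B' i)" using f(1) B'_simps(2) by (auto simp: PiE_iff)
          then show "f(Suc s := y) \<in> (\<Pi>\<^sub>E i\<in>{1..Suc s}. B' i)"
            unfolding set using y(1) B'_simps(1) by (intro PiE_fun_upd) auto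
          have "(\<Sum>i\<in>{1..s}. (f(Suc s := y)) i) = x - y"
            unfolding f(2) by (intro sum.cong) auto
          then show "x = (\<Sum>i\<in>{1..Suc s}. (f(Suc s := y)) i)" by (simp add: set)
        qed
        fix g assume g: "g \<in> (\<Pi>\<^sub>E i\<in>{1..Suc s}. B' i) \<and> x = (\<Sum>i\<in>{1..Suc s}. g i)"
        define z where "z = (\<Sum>i\<in>{1..s}. g i)"
        have gi: "g i \<in> B i" if "i \<in> {1..s}" for i
          using g that B'_simps(2)[OF that] by (auto simp: PiE_iff)
        have gs: "g (Suc s) \<in> I" using g B'_simps(1) by (auto simp: PiE_iff)
        have zM': "z \<in> M'"
          unfolding z_def using gi B by (intro subspace_sum sM') blast
        have xe: "x = g (Suc s) + z" using g by (simp add: set z_def)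
        have "y - g (Suc s) = z - (x - y)" by (simp add: xe)
        then have "y - g (Suc s) \<in> M'"
          using subspace_diff[OF sM' zM' xy] by (simp only:)
        then have "y - g (Suc s) \<in> I \<inter> M'"
          using subspace_diff[OF sI y(1) gs] by simp
        then have ge: "g (Suc s) = y" using disj by simp
        have "restrict g {1..s} = f"
          by (rule uniq) (use gi in \<open>auto simp: xe ge z_def\<close>)
        then have f_eq: "f = restrict g {1..s}" by simp
        show "g = f(Suc s := y)"
        proof
          fix i
          have out: "g i = undefined" if "i \<notin> {1..Suc s}" by (rule PiE_arb[OF conjunct1[OF g] that])
          show "g i = (f(Suc s := y)) i"
          proof (cases "i = Suc s")
            case True
            then show ?thesis by (simp add: ge)
          next
            case False
            have "g i = restrict g {1..s} i"
            proof (cases "i \<in> {1..s}")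
              case True
              then show ?thesis by (rule restrict_apply'[symmetric])
            next
              case n: False
              then have "i \<notin> {1..Suc s}" using False by auto
              then have "g i = undefined" by (rule out)
              then show ?thesis using n by (simp only: restrict_def if_False)
            qed
            then show ?thesis by (simp only: f_eq fun_upd_other[OF False])
          qed
        qed
      qed
    qed
    moreover have "\<forall>i\<in>{1..Suc s}. lie_ideal (B' i) UNIV \<and> H_submodule (B' i) \<and> H_simple (B' i) \<and> B' i \<subseteq> M"
      using B Ii IH simple IM by (auto simp: B'_def M'_def)
    ultimately show ?thesis by blast
  qed
qed

end

theorem theorem6:
  fixes scaleH :: "'k::field_char_0 \<Rightarrow> 'h::ring_1 \<Rightarrow> 'h"
    and \<Delta> :: "'h \<Rightarrow> ('h \<times> 'h \<Rightarrow>\<^sub>0 'k) set"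
    and \<epsilon> :: "'h \<Rightarrow> 'k"
    and S :: "'h \<Rightarrow> 'h"
    and scaleB :: "'k \<Rightarrow> 'b::ab_group_add \<Rightarrow> 'b"
    and bracket :: "'b \<Rightarrow> 'b \<Rightarrow> 'b"
    and act :: "'h \<Rightarrow> 'b \<Rightarrow> 'b"
  assumes "H_module_lie_algebra scaleH \<Delta> \<epsilon> S scaleB bracket act"
    and "\<exists>Basis. finite_dimensional_vector_space scaleB Basis"
    and "lie_algebra.semisimple scaleB bracket"
  shows "\<exists>s\<ge>1. \<exists>B :: nat \<Rightarrow> 'b set.
    lie_algebra.direct_sum scaleB s B \<and>
    (\<forall>i\<in>{1..s}.
      lie_algebra.lie_ideal scaleB bracket (B i) UNIV \<and>
      H_module_lie_algebra.H_submodule scaleB act (B i) \<and>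
      H_module_lie_algebra.H_simple scaleB bracket act (B i))"
proof -
  interpret H_module_lie_algebra scaleH \<Delta> \<epsilon> S scaleB bracket act by fact
  obtain Basis where Basis: "finite_dimensional_vector_space scaleB Basis" using assms(2) by blast
  interpret finite_dimensional_vector_space scaleB Basis by fact
  interpret semisimple_H_module_lie_algebra scaleH \<Delta> \<epsilon> S scaleB bracket act Basis
    by unfold_locales (fact assms(3))
  have U: "lie_ideal UNIV UNIV" "H_submodule UNIV"
    by (auto simp: lie_ideal_def H_submodule_def)
  obtain s B where sB: "(\<forall>i\<in>{1..s::nat}.
        lie_ideal (B i) UNIV \<and> H_submodule (B i) \<and> H_simple (B i) \<and> B i \<subseteq> UNIV) \<and>
      (\<forall>x\<in>UNIV. \<exists>!f. f \<in> (\<Pi>\<^sub>E i\<in>{1..s}. B i) \<and> x = (\<Sum>i\<in>{1..s}. f i))"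
    using H_ideal_decomposition[OF U] by (elim exE)
  note B = bspec[OF conjunct1[OF sB]] and dec = bspec[OF conjunct2[OF sB] UNIV_I]
  show ?thesis
  proof (cases "s = 0")
    case False
    then show ?thesis
      using B dec by (intro exI[of _ s] conjI exI[of _ B]) (auto simp: direct_sum_def H_submodule_def)
  next
    case True
    \<comment> \<open>For \<open>B = 0\<close> the empty sum is replaced by one summand, as at least one is required.\<close>
    then have zero: "x = 0" for x :: 'b using dec[of x] by auto
    have "H_simple UNIV"
      unfolding H_simple_def lie_subalgebra_def lie_ideal_def
      using U(2) zero by (auto simp: H_submodule_def subspace_def)
    moreover have "direct_sum 1 (\<lambda>_. UNIV)"
      unfolding direct_sum_def
      using zero by (auto intro!: ex1I[of _ "\<lambda>i\<in>{1::nat}. 0 :: 'b"] simp: fun_eq_iff PiE_iff extensional_def)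
    ultimately show ?thesis
      using U by (intro exI[of _ 1] conjI exI[of _ "\<lambda>_. UNIV"]) auto
  qed
qed

end
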